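(* Let $\langle X_i:i\in\omega\rangle$ be a sequence of finite nonempty sets, $n_i$ a good norm on $X_i$ for each $i$, $m_i=n_0*n_1*\dots*n_i$, and $k=\lim_im_i$ the limit norm on $X=\prod_iX_i$ (with the product topology). Then the derived submeasure $c(A)=k(\chi_A)$, $A\subseteq X$, is an outer regular stable capacity on $X$.
   Context: A good norm on a set $Y$ is a norm $n$ on functions $f\in\mathbb{R}^Y$ (values in $[0,\infty)$) such that $|f|\le|g|$ pointwise implies $n(f)\le n(g)$, $n(1)=1$, and, if $Y$ is finite, $|f|<|g|$ implies $n(f)<n(g)$. For good norms $n$ on $Y$ and $m$ on $Z$, the iteration $n*m$ on $Y\times Z$ is $(n*m)(f)=n(y\mapsto m(z\mapsto f(y,z)))$. The limit $k=\lim_i m_i$ on $X=\prod_iX_i$: for a nonnegative step function $f$ (there is $j$ such that $f(x)$ depends only on $x\restriction(j+1)$, say $f(x)=f^*(x\restriction(j+1))$ with $f^*$ defined on $X_0\times\dots\times X_j$) put $k(f)=m_j(f^* )$; for a nonnegative lower semicontinuous $g=\sup_nf_n$ with $f_0\le f_1\le\dots$ nonnegative step functions put $k(g)=\sup_nk(f_n)$; for arbitrary $h$ put $k(h)=\inf\{k(g):|h|\le g,\ g \text{ lower semicontinuous}\}$. A capacity on a Polish space $X$ is $c:\mathcal{P}(X)\to[0,\infty]$ with $c(\emptyset)=0$, monotone, $c(A\cup B)\le c(A)+c(B)$, $c(\bigcup_nA_n)=\sup_nc(A_n)$ for inclusion-increasing sequences, $c(K)<\infty$ for compact $K$; outer regular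 means $c(A)=\inf\{c(O):O\supseteq A$ open$\}$. Stable: for every open $A$ there is a Borel $\tilde A\supseteq A$ with $c(\tilde A)=c(A)$ such that $c(A\cup B)>c(A)$ whenever $B\subseteq X\setminus\tilde A$ and $c(B)>0$. *)

theory Defs
  imports "HOL-Analysis.Analysis"
begin

text \<open>
  A norm on \<open>\<real>\<^sup>Y\<close> is a functional on all functions of the ambient type. The laws only look at
  values on \<open>Y\<close>; monotonicity then forces \<open>n f\<close> to depend on the restriction of \<open>f\<close> to \<open>Y\<close> only.
  In the last clause \<open>\<bar>f\<bar> < \<bar>g\<bar>\<close> is the strict part of the pointwise order:
  \<open>\<bar>f\<bar> \<le> \<bar>g\<bar>\<close> and \<open>\<bar>f\<bar> \<noteq> \<bar>g\<bar>\<close> on \<open>Y\<close>.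
\<close>

definition norm_on :: "'y set \<Rightarrow> (('y \<Rightarrow> real) \<Rightarrow> real) \<Rightarrow> bool" where
  "norm_on Y n \<longleftrightarrow>
     (\<forall>f. 0 \<le> n f) \<and>
     (\<forall>f. n f = 0 \<longleftrightarrow> (\<forall>y\<in>Y. f y = 0)) \<and>
     (\<forall>a f. n (\<lambda>y. a * f y) = \<bar>a\<bar> * n f) \<and>
     (\<forall>f g. n (\<lambda>y. f y + g y) \<le> n f + n g)"

definition good_norm :: "'y set \<Rightarrow> (('y \<Rightarrow> real) \<Rightarrow> real) \<Rightarrow> bool" where
  "good_norm Y n \<longleftrightarrow>
     norm_on Y n \<and>
     (\<forall>f g. (\<forall>y\<in>Y. \<bar>f y\<bar> \<le> \<bar>g y\<bar>) \<longrightarrow> n f \<le> n g) \<and>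
     n (\<lambda>_. 1) = 1 \<and>
     (finite Y \<longrightarrow>
        (\<forall>f g. (\<forall>y\<in>Y. \<bar>f y\<bar> \<le> \<bar>g y\<bar>) \<and> (\<exists>y\<in>Y. \<bar>f y\<bar> \<noteq> \<bar>g y\<bar>) \<longrightarrow> n f < n g))"

definition norm_iteration ::
    "(('y \<Rightarrow> real) \<Rightarrow> real) \<Rightarrow> (('z \<Rightarrow> real) \<Rightarrow> real) \<Rightarrow> ('y \<times> 'z \<Rightarrow> real) \<Rightarrow> real" where
  "norm_iteration n m f = n (\<lambda>y. m (\<lambda>z. f (y, z)))"

text \<open>
  \<open>iterated_norm n i\<close> is \<open>n 0 * \<dots> * n i\<close> as a norm on \<open>Pi\<^sub>E {..i} X\<close>, where
  \<open>Pi\<^sub>E {..i} X \<times> X (Suc i)\<close> is identified with \<open>Pi\<^sub>E {..Suc i} X\<close> by appending the last coordinate.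
\<close>

primrec iterated_norm ::
    "(nat \<Rightarrow> ('a \<Rightarrow> real) \<Rightarrow> real) \<Rightarrow> nat \<Rightarrow> ((nat \<Rightarrow> 'a) \<Rightarrow> real) \<Rightarrow> real" where
  "iterated_norm n 0 = (\<lambda>f. n 0 (\<lambda>a. f ((\<lambda>_. undefined)(0 := a))))"
| "iterated_norm n (Suc i) =
     (\<lambda>f. norm_iteration (iterated_norm n i) (n (Suc i)) (\<lambda>(s, a). f (s(Suc i := a))))"

abbreviation product_space :: "(nat \<Rightarrow> 'a set) \<Rightarrow> (nat \<Rightarrow> 'a) topology" where
  "product_space X \<equiv> product_topology (\<lambda>i. discrete_topology (X i)) UNIV"

definition step_witness ::
    "(nat \<Rightarrow> 'a set) \<Rightarrow> ((nat \<Rightarrow> 'a) \<Rightarrow> real) \<Rightarrow> nat \<Rightarrow> ((nat \<Rightarrow> 'a) \<Rightarrow> real) \<Rightarrow> bool" where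
  "step_witness X f j f' \<longleftrightarrow> (\<forall>x\<in>Pi\<^sub>E UNIV X. f x = f' (restrict x {..j}))"

definition nonneg_step :: "(nat \<Rightarrow> 'a set) \<Rightarrow> ((nat \<Rightarrow> 'a) \<Rightarrow> real) \<Rightarrow> bool" where
  "nonneg_step X f \<longleftrightarrow> (\<forall>x\<in>Pi\<^sub>E UNIV X. 0 \<le> f x) \<and> (\<exists>j f'. step_witness X f j f')"

definition lower_semicontinuous :: "'x topology \<Rightarrow> ('x \<Rightarrow> real) \<Rightarrow> bool" where
  "lower_semicontinuous T g \<longleftrightarrow> (\<forall>r. openin T {x \<in> topspace T. r < g x})"

definition step_approximation ::
    "(nat \<Rightarrow> 'a set) \<Rightarrow> (nat \<Rightarrow> (nat \<Rightarrow> 'a) \<Rightarrow> real) \<Rightarrow> ((nat \<Rightarrow> 'a) \<Rightarrow> real) \<Rightarrow> bool" where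
  "step_approximation X f g \<longleftrightarrow>
     (\<forall>i. nonneg_step X (f i)) \<and>
     (\<forall>x\<in>Pi\<^sub>E UNIV X. \<forall>i. f i x \<le> f (Suc i) x) \<and>
     (\<forall>x\<in>Pi\<^sub>E UNIV X. (SUP i. ennreal (f i x)) = ennreal (g x))"

text \<open>
  The limit norm, in three stages. The first two stages take the common value over all
  representations \<open>f'\<close>, respectively over all increasing approximations by step functions.
\<close>

definition limit_norm_step ::
    "(nat \<Rightarrow> 'a set) \<Rightarrow> (nat \<Rightarrow> ((nat \<Rightarrow> 'a) \<Rightarrow> real) \<Rightarrow> real) \<Rightarrow> ((nat \<Rightarrow> 'a) \<Rightarrow> real) \<Rightarrow> real" where
  "limit_norm_step X m f = (THE r. \<exists>j f'. step_witness X f j f' \<and> r = m j f')"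

definition limit_norm_lsc ::
    "(nat \<Rightarrow> 'a set) \<Rightarrow> (nat \<Rightarrow> ((nat \<Rightarrow> 'a) \<Rightarrow> real) \<Rightarrow> real) \<Rightarrow> ((nat \<Rightarrow> 'a) \<Rightarrow> real) \<Rightarrow> ennreal" where
  "limit_norm_lsc X m g =
     (THE r. \<exists>f. step_approximation X f g \<and> r = (SUP i. ennreal (limit_norm_step X m (f i))))"

definition limit_norm ::
    "(nat \<Rightarrow> 'a set) \<Rightarrow> (nat \<Rightarrow> ((nat \<Rightarrow> 'a) \<Rightarrow> real) \<Rightarrow> real) \<Rightarrow> ((nat \<Rightarrow> 'a) \<Rightarrow> real) \<Rightarrow> ennreal" where
  "limit_norm X m h =
     Inf {limit_norm_lsc X m g | g.
            lower_semicontinuous (product_space X) g \<and> (\<forall>x\<in>Pi\<^sub>E UNIV X. \<bar>h x\<bar> \<le> g x)}"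

definition derived_submeasure :: "(('x \<Rightarrow> real) \<Rightarrow> ennreal) \<Rightarrow> 'x set \<Rightarrow> ennreal" where
  "derived_submeasure k A = k (indicator A)"

definition Polish_space :: "'x topology \<Rightarrow> bool" where
  "Polish_space T \<longleftrightarrow> completely_metrizable_space T \<and> separable_space T"

definition capacity_on :: "'x topology \<Rightarrow> ('x set \<Rightarrow> ennreal) \<Rightarrow> bool" where
  "capacity_on T c \<longleftrightarrow>
     Polish_space T \<and>
     c {} = 0 \<and>
     (\<forall>A B. A \<subseteq> B \<and> B \<subseteq> topspace T \<longrightarrow> c A \<le> c B) \<and>
     (\<forall>A B. A \<subseteq> topspace T \<and> B \<subseteq> topspace T \<longrightarrow> c (A \<union> B) \<le> c A + c B) \<and>
     (\<forall>A :: nat \<Rightarrow> 'x set. (\<forall>i. A i \<subseteq> topspace T) \<and> incseq A \<longrightarrow> c (\<Union>i. A i) = (SUP i. c (A i))) \<and>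
     (\<forall>K. compactin T K \<longrightarrow> c K < \<infinity>)"

definition outer_regular :: "'x topology \<Rightarrow> ('x set \<Rightarrow> ennreal) \<Rightarrow> bool" where
  "outer_regular T c \<longleftrightarrow> (\<forall>A\<subseteq>topspace T. c A = Inf {c U | U. openin T U \<and> A \<subseteq> U})"

definition stable_capacity :: "'x topology \<Rightarrow> ('x set \<Rightarrow> ennreal) \<Rightarrow> bool" where
  "stable_capacity T c \<longleftrightarrow>
     (\<forall>A. openin T A \<longrightarrow>
        (\<exists>A' \<in> sigma_sets (topspace T) {U. openin T U}.
           A \<subseteq> A' \<and> c A' = c A \<and>
           (\<forall>B. B \<subseteq> topspace T - A' \<and> 0 < c B \<longrightarrow> c A < c (A \<union> B))))"

end

theory Submission
  imports Defs "HOL-Library.Sublist"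
begin

text \<open>
  Call \<open>g\<close> on the tree of finite sequences a supermartingale if \<open>n\<^sub>i (a \<mapsto> g (s a)) \<le> g s\<close>
  at each node \<open>s\<close> of length \<open>i\<close>. The capacity of \<open>A\<close> is the least starting value of a
  supermartingale that reaches 1 along every branch in \<open>A\<close>; starting at a node \<open>s\<close> instead of the
  root gives a conditional capacity \<open>c\<^sub>s(A)\<close>, and optional stopping shows that \<open>s \<mapsto> c\<^sub>s(A)\<close> is a
  martingale.

  Two facts drive everything. The maximal inequality bounds the capacity of
  \<open>{x. \<exists>j. c\<^bsub>x|j\<^esub>(A) \<ge> \<theta>}\<close> by \<open>c(A) / \<theta>\<close>. The density theorem says that a set \<open>B\<close> with
  \<open>c\<^sub>s(B) \<le> \<theta> < 1\<close> at all nodes is null, because \<open>\<theta> g\<close> dominates \<open>c(B)\<close> for each competitor \<open>g\<close>.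
  For increasing \<open>A\<^sub>i\<close>, the supremum of the martingales \<open>c\<^sub>s(A\<^sub>i)\<close> is a supermartingale that comes
  arbitrarily close to 1 along all branches in \<open>\<Union>A\<^sub>i\<close> outside a null set, which gives continuity
  from below. For stability, \<open>A'\<close> adds to \<open>A\<close> the points where \<open>c\<^bsub>x|j\<^esub>(A)\<close> comes arbitrarily close
  to 1; a non-null \<open>B\<close> outside \<open>A'\<close> has a node with \<open>c\<^sub>s(B) > \<theta> \<ge> c\<^sub>s(A)\<close>, and strict monotonicity
  of the norms carries the strict inequality \<open>c\<^sub>s(A) < c\<^sub>s(A \<union> B)\<close> down to the root.
\<close>

section \<open>Good norms\<close>

lemma good_norm_nonneg: "good_norm Y m \<Longrightarrow> 0 \<le> m f"
  by (simp add: good_norm_def norm_on_def)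

lemma good_norm_mono_abs: "good_norm Y m \<Longrightarrow> (\<And>y. y \<in> Y \<Longrightarrow> \<bar>f y\<bar> \<le> \<bar>g y\<bar>) \<Longrightarrow> m f \<le> m g"
  by (simp add: good_norm_def)

lemma good_norm_mono:
  "good_norm Y m \<Longrightarrow> (\<And>y. y \<in> Y \<Longrightarrow> 0 \<le> f y) \<Longrightarrow> (\<And>y. y \<in> Y \<Longrightarrow> f y \<le> g y) \<Longrightarrow> m f \<le> m g"
  by (erule good_norm_mono_abs) force

lemma good_norm_strict_mono:
  assumes "good_norm Y m" "finite Y" "\<And>y. y \<in> Y \<Longrightarrow> 0 \<le> f y" "\<And>y. y \<in> Y \<Longrightarrow> f y \<le> g y"
    and "z \<in> Y" "f z < g z"
  shows "m f < m g"
proof -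
  have "\<forall>y\<in>Y. \<bar>f y\<bar> \<le> \<bar>g y\<bar>" using assms(3,4) by force
  moreover have "\<exists>y\<in>Y. \<bar>f y\<bar> \<noteq> \<bar>g y\<bar>" using assms(3)[OF assms(5)] assms(5,6) by force
  ultimately show ?thesis using assms(1,2) unfolding good_norm_def by blast
qed

lemma good_norm_cong: "good_norm Y m \<Longrightarrow> (\<And>y. y \<in> Y \<Longrightarrow> f y = g y) \<Longrightarrow> m f = m g"
  by (rule antisym; erule good_norm_mono_abs) auto

lemma good_norm_scale: "good_norm Y m \<Longrightarrow> m (\<lambda>y. a * f y) = \<bar>a\<bar> * m f"
  by (simp add: good_norm_def norm_on_def)

lemma good_norm_const: "good_norm Y m \<Longrightarrow> m (\<lambda>_. a) = \<bar>a\<bar>"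
  using good_norm_scale[of Y m a "\<lambda>_. 1"] by (simp add: good_norm_def)

lemma good_norm_add: "good_norm Y m \<Longrightarrow> m (\<lambda>y. f y + g y) \<le> m f + m g"
  by (simp add: good_norm_def norm_on_def)

lemma good_norm_le_sum_abs:
  assumes "good_norm Y m" "finite Y"
  shows "m f \<le> (\<Sum>y\<in>Y. \<bar>f y\<bar>)"
proof -
  have "m f \<le> m (\<lambda>_. \<Sum>y\<in>Y. \<bar>f y\<bar>)"
    by (rule good_norm_mono_abs[OF assms(1)])
      (use assms(2) in \<open>auto intro: member_le_sum order_trans[OF _ abs_ge_self]\<close>)
  then show ?thesis
    by (simp add: good_norm_const[OF assms(1)] sum_nonneg)
qed

lemma good_norm_diff_le:
  assumes "good_norm Y m"
  shows "\<bar>m f - m g\<bar> \<le> m (\<lambda>y. f y - g y)"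
proof -
  have "m (\<lambda>y. g y - f y) = m (\<lambda>y. f y - g y)"
    using good_norm_scale[OF assms, of "-1" "\<lambda>y. f y - g y"] by simp
  then show ?thesis
    using good_norm_add[OF assms, of "\<lambda>y. f y - g y" g] good_norm_add[OF assms, of "\<lambda>y. g y - f y" f]
    by simp
qed

lemma good_norm_tendsto:
  assumes m: "good_norm Y m" "finite Y"
    and F: "\<And>y. y \<in> Y \<Longrightarrow> ((\<lambda>k. F k y) \<longlongrightarrow> G y) net"
  shows "((\<lambda>k. m (F k)) \<longlongrightarrow> m G) net"
proof (rule LIM_zero_cancel, rule Lim_null_comparison)
  have "\<bar>m (F k) - m G\<bar> \<le> (\<Sum>y\<in>Y. \<bar>F k y - G y\<bar>)" for k
    using good_norm_diff_le[OF m(1)] good_norm_le_sum_abs[OF m] by (rule order_trans)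
  then show "\<forall>\<^sub>F k in net. norm (m (F k) - m G) \<le> (\<Sum>y\<in>Y. \<bar>F k y - G y\<bar>)"
    by simp
  show "((\<lambda>k. \<Sum>y\<in>Y. \<bar>F k y - G y\<bar>) \<longlongrightarrow> 0) net"
    by (rule tendsto_null_sum) (simp add: F LIM_zero tendsto_rabs_zero)
qed

section \<open>Finite prefixes and the product topology\<close>

definition prefix_of :: "(nat \<Rightarrow> 'a) \<Rightarrow> nat \<Rightarrow> 'a list" where
  "prefix_of x j = map x [0..<j]"

lemma length_prefix_of [simp]: "length (prefix_of x j) = j"
  by (simp add: prefix_of_def)

lemma prefix_of_0 [simp]: "prefix_of x 0 = []"
  by (simp add: prefix_of_def)

lemma prefix_of_Suc: "prefix_of x (Suc j) = prefix_of x j @ [x j]"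
  by (simp add: prefix_of_def)

lemma prefix_of_eq_iff: "prefix_of x j = prefix_of y j \<longleftrightarrow> (\<forall>i<j. x i = y i)"
  by (auto simp: prefix_of_def)

lemma prefix_of_eq_mono: "prefix_of x j = prefix_of y j \<Longrightarrow> i \<le> j \<Longrightarrow> prefix_of x i = prefix_of y i"
  by (simp add: prefix_of_eq_iff)

lemma prefix_prefix_of_iff: "prefix s (prefix_of x j) \<longleftrightarrow> length s \<le> j \<and> prefix_of x (length s) = s"
proof -
  have "prefix s t \<longleftrightarrow> length s \<le> length t \<and> take (length s) t = s" for t :: "'a list"
    by (metis append_eq_conv_conj prefix_def prefix_length_le take_is_prefix)
  moreover have "take i (prefix_of x j) = prefix_of x i" if "i \<le> j" for i
    using that by (simp add: prefix_of_def take_map)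
  ultimately show ?thesis by auto
qed

definition cylinder :: "(nat \<Rightarrow> 'a set) \<Rightarrow> 'a list \<Rightarrow> (nat \<Rightarrow> 'a) set" where
  "cylinder X s = {x \<in> Pi\<^sub>E UNIV X. prefix_of x (length s) = s}"

lemma in_cylinder_prefix_of:
  "y \<in> cylinder X (prefix_of x N) \<longleftrightarrow> y \<in> Pi\<^sub>E UNIV X \<and> prefix_of y N = prefix_of x N"
  by (simp add: cylinder_def)

lemma cylinder_prefix_of_antimono:
  "N \<le> M \<Longrightarrow> cylinder X (prefix_of x M) \<subseteq> cylinder X (prefix_of x N)"
  by (auto simp: in_cylinder_prefix_of intro: prefix_of_eq_mono)

lemma topspace_product_space: "topspace (product_space X) = Pi\<^sub>E UNIV X"
  by simp

lemma openin_cylinder: "openin (product_space X) (cylinder X s)"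
proof (induction s rule: rev_induct)
  case Nil
  have "cylinder X [] = topspace (product_space X)" by (simp add: cylinder_def)
  then show ?case by (simp only: openin_topspace)
next
  case (snoc a s)
  have "openin (product_space X) {x \<in> topspace (product_space X). x (length s) \<in> {a} \<inter> X (length s)}"
    by (rule openin_continuous_map_preimage[OF continuous_map_product_projection]) auto
  moreover have "cylinder X (s @ [a]) =
      cylinder X s \<inter> {x \<in> topspace (product_space X). x (length s) \<in> {a} \<inter> X (length s)}"
    by (auto simp: cylinder_def prefix_of_Suc PiE_iff)
  ultimately show ?case using snoc.IH by (simp only: openin_Int)
qed

lemma cylinder_subset_openin:
  assumes "openin (product_space X) S" "x \<in> S"
  shows "\<exists>N. cylinder X (prefix_of x N) \<subseteq> S"
proof -
  obtain U where U: "finite {i. U i \<noteq> X i}" "x \<in> Pi\<^sub>E UNIV U" "Pi\<^sub>E UNIV U \<subseteq> S"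
    using assms unfolding openin_product_topology_alt by auto
  obtain N where N: "\<And>i. U i \<noteq> X i \<Longrightarrow> i < N"
    using finite_nat_set_iff_bounded U(1) by auto
  have "y i \<in> U i" if "y \<in> cylinder X (prefix_of x N)" for y i
    using that U(2) N[of i]
    by (cases "i < N") (force simp: in_cylinder_prefix_of prefix_of_eq_iff PiE_iff)+
  then have "cylinder X (prefix_of x N) \<subseteq> Pi\<^sub>E UNIV U" by (auto simp: PiE_iff)
  with U(3) show ?thesis by blast
qed

lemma Polish_product_space:
  assumes "\<And>i. countable (X i)"
  shows "Polish_space (product_space X)"
  unfolding Polish_space_def
proof
  show "completely_metrizable_space (product_space X)"
    by (simp add: completely_metrizable_space_product_topology completely_metrizable_space_discrete_topology)
  have "second_countable (product_space X)"
    unfolding second_countable_def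
  proof (intro exI[of _ "cylinder X ` lists (\<Union>i. X i)"] conjI ballI allI impI)
    show "countable (cylinder X ` lists (\<Union>i. X i))"
      using assms by (intro countable_image countable_lists countable_UN) auto
    show "openin (product_space X) V" if "V \<in> cylinder X ` lists (\<Union>i. X i)" for V
      using that openin_cylinder by blast
    fix U x assume U: "openin (product_space X) U \<and> x \<in> U"
    then obtain N where N: "cylinder X (prefix_of x N) \<subseteq> U"
      using cylinder_subset_openin by blast
    have x: "x \<in> Pi\<^sub>E UNIV X" using U openin_subset by fastforce
    show "\<exists>V\<in>cylinder X ` lists (\<Union>i. X i). x \<in> V \<and> V \<subseteq> U"
    proof (intro bexI[of _ "cylinder X (prefix_of x N)"] conjI imageI N)
      show "x \<in> cylinder X (prefix_of x N)" using x by (simp add: in_cylinder_prefix_of)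
      show "prefix_of x N \<in> lists (\<Union>i. X i)" using PiE_mem[OF x] by (fastforce simp: prefix_of_def)
    qed
  qed
  then show "separable_space (product_space X)" by (rule second_countable_imp_separable_space)
qed

definition depends_below :: "(nat \<Rightarrow> 'a set) \<Rightarrow> nat \<Rightarrow> ((nat \<Rightarrow> 'a) \<Rightarrow> 'b) \<Rightarrow> bool" where
  "depends_below X N f \<longleftrightarrow>
     (\<forall>x\<in>Pi\<^sub>E UNIV X. \<forall>y\<in>Pi\<^sub>E UNIV X. prefix_of x N = prefix_of y N \<longrightarrow> f x = f y)"

lemma depends_belowI:
  "(\<And>x y. x \<in> Pi\<^sub>E UNIV X \<Longrightarrow> y \<in> Pi\<^sub>E UNIV X \<Longrightarrow> prefix_of x N = prefix_of y N \<Longrightarrow> f x = f y) \<Longrightarrow>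
    depends_below X N f"
  unfolding depends_below_def by blast

lemma depends_belowD:
  "depends_below X N f \<Longrightarrow> x \<in> Pi\<^sub>E UNIV X \<Longrightarrow> y \<in> Pi\<^sub>E UNIV X \<Longrightarrow> prefix_of x N = prefix_of y N \<Longrightarrow> f x = f y"
  unfolding depends_below_def by blast

lemma depends_below_mono: "depends_below X N f \<Longrightarrow> N \<le> M \<Longrightarrow> depends_below X M f"
  unfolding depends_below_def using prefix_of_eq_mono by blast

lemma depends_below_compose: "depends_below X N f \<Longrightarrow> depends_below X N (\<lambda>x. h (f x))"
  unfolding depends_below_def by metis

lemma depends_below_compose2:
  "depends_below X N f \<Longrightarrow> depends_below X N g \<Longrightarrow> depends_below X N (\<lambda>x. h (f x) (g x))"
  unfolding depends_below_def by metis

lemma depends_below_prefix_of: "depends_below X N (\<lambda>x. h (prefix_of x N))"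
  unfolding depends_below_def by simp

lemma depends_below_indicator:
  assumes "depends_below X N (\<lambda>x. x \<in> U)"
  shows "depends_below X N (indicator U :: _ \<Rightarrow> 'b::zero_neq_one)"
proof -
  have "(indicator U :: _ \<Rightarrow> 'b) = (\<lambda>x. of_bool (x \<in> U))" by (simp add: fun_eq_iff indicator_def)
  then show ?thesis using depends_below_compose[OF assms, of of_bool] by simp
qed

lemma openin_depends_below:
  assumes "depends_below X N P"
  shows "openin (product_space X) {x \<in> Pi\<^sub>E UNIV X. P x}"
proof (subst openin_subopen, intro ballI exI conjI)
  fix x assume x: "x \<in> {x \<in> Pi\<^sub>E UNIV X. P x}"
  show "openin (product_space X) (cylinder X (prefix_of x N))" by (rule openin_cylinder)
  show "x \<in> cylinder X (prefix_of x N)" using x by (simp add: in_cylinder_prefix_of)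
  show "cylinder X (prefix_of x N) \<subseteq> {x \<in> Pi\<^sub>E UNIV X. P x}"
  proof
    fix y assume "y \<in> cylinder X (prefix_of x N)"
    then have y: "y \<in> Pi\<^sub>E UNIV X" "prefix_of y N = prefix_of x N"
      by (simp_all add: in_cylinder_prefix_of)
    then have "P y = P x" using x by (intro depends_belowD[OF assms]) auto
    with x y show "y \<in> {x \<in> Pi\<^sub>E UNIV X. P x}" by simp
  qed
qed

lemma closedin_depends_below:
  assumes "depends_below X N P"
  shows "closedin (product_space X) {x \<in> Pi\<^sub>E UNIV X. P x}"
proof -
  have "topspace (product_space X) - {x \<in> Pi\<^sub>E UNIV X. P x} = {x \<in> Pi\<^sub>E UNIV X. \<not> P x}" by auto
  then show ?thesis
    using openin_depends_below[OF depends_below_compose[OF assms]] by (auto simp: closedin_def)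
qed

lemma openin_ex_prefix_of: "openin (product_space X) {x \<in> Pi\<^sub>E UNIV X. \<exists>j. P (prefix_of x j)}"
proof -
  have "{x \<in> Pi\<^sub>E UNIV X. \<exists>j. P (prefix_of x j)} = (\<Union>j. {x \<in> Pi\<^sub>E UNIV X. P (prefix_of x j)})"
    by blast
  also have "openin (product_space X) \<dots>"
    using openin_depends_below[OF depends_below_prefix_of] by blast
  finally show ?thesis .
qed

section \<open>Supermartingales\<close>

definition switch_at ::
    "('a list \<Rightarrow> bool) \<Rightarrow> ('a list \<Rightarrow> real) \<Rightarrow> ('a list \<Rightarrow> 'a list \<Rightarrow> real) \<Rightarrow> 'a list \<Rightarrow> real" where
  "switch_at P W G u = (case List.find P (prefixes u) of None \<Rightarrow> W u | Some v \<Rightarrow> G v u)"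

lemma find_append:
  "List.find P (xs @ ys) =
    (case List.find P xs of None \<Rightarrow> List.find P ys | Some v \<Rightarrow> Some v)"
  by (induction xs) auto

lemma find_prefixes_SomeD:
  assumes "List.find P (prefixes u) = Some v"
  shows "P v" "prefix v u"
  using assms by (auto simp: find_Some_iff simp flip: in_set_prefixes)

lemma find_prefixes_prefix_of_mono:
  assumes "i \<le> j" "List.find P (prefixes (prefix_of x i)) = Some v"
  shows "List.find P (prefixes (prefix_of x j)) = Some v"
  using assms by (induction j rule: dec_induct) (auto simp: prefix_of_Suc find_append)

locale good_norm_sequence =
  fixes X :: "nat \<Rightarrow> 'a set" and n :: "nat \<Rightarrow> ('a \<Rightarrow> real) \<Rightarrow> real"
  assumes finite_X: "finite (X i)"
    and nonempty_X: "X i \<noteq> {}"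
    and good: "good_norm (X i) (n i)"
begin

definition child_norm :: "('a list \<Rightarrow> real) \<Rightarrow> 'a list \<Rightarrow> real" where
  "child_norm g u = n (length u) (\<lambda>a. g (u @ [a]))"

lemma child_norm_nonneg: "0 \<le> child_norm g u"
  by (simp add: child_norm_def good_norm_nonneg[OF good])

lemma child_norm_mono:
  "(\<And>a. a \<in> X (length u) \<Longrightarrow> 0 \<le> g (u @ [a])) \<Longrightarrow>
   (\<And>a. a \<in> X (length u) \<Longrightarrow> g (u @ [a]) \<le> h (u @ [a])) \<Longrightarrow> child_norm g u \<le> child_norm h u"
  unfolding child_norm_def by (rule good_norm_mono[OF good])

lemma child_norm_strict_mono:
  "(\<And>v. 0 \<le> g v) \<Longrightarrow> (\<And>v. g v \<le> h v) \<Longrightarrow> a \<in> X (length u) \<Longrightarrow> g (u @ [a]) < h (u @ [a]) \<Longrightarrow>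
    child_norm g u < child_norm h u"
  unfolding child_norm_def by (rule good_norm_strict_mono[OF good finite_X])

lemma child_norm_cong:
  "(\<And>a. a \<in> X (length u) \<Longrightarrow> g (u @ [a]) = h (u @ [a])) \<Longrightarrow> child_norm g u = child_norm h u"
  unfolding child_norm_def by (rule good_norm_cong[OF good])

lemma child_norm_const: "child_norm (\<lambda>_. r) u = \<bar>r\<bar>"
  by (simp add: child_norm_def good_norm_const[OF good])

lemma child_norm_scale: "child_norm (\<lambda>v. r * g v) u = \<bar>r\<bar> * child_norm g u"
  by (simp add: child_norm_def good_norm_scale[OF good])

lemma child_norm_add: "child_norm (\<lambda>v. g v + h v) u \<le> child_norm g u + child_norm h u"
  by (simp add: child_norm_def good_norm_add[OF good])

lemma child_norm_tendsto:
  "(\<And>v. ((\<lambda>k. F k v) \<longlongrightarrow> G v) net) \<Longrightarrow> ((\<lambda>k. child_norm (F k) u) \<longlongrightarrow> child_norm G u) net"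
  unfolding child_norm_def by (rule good_norm_tendsto[OF good finite_X])

definition supermartingale :: "('a list \<Rightarrow> real) \<Rightarrow> bool" where
  "supermartingale g \<longleftrightarrow> (\<forall>u. 0 \<le> g u \<and> child_norm g u \<le> g u)"

lemma supermartingaleI:
  "(\<And>u. 0 \<le> g u) \<Longrightarrow> (\<And>u. child_norm g u \<le> g u) \<Longrightarrow> supermartingale g"
  by (simp add: supermartingale_def)

lemma supermartingale_nonneg: "supermartingale g \<Longrightarrow> 0 \<le> g u"
  by (simp add: supermartingale_def)

lemma supermartingale_child_norm_le: "supermartingale g \<Longrightarrow> child_norm g u \<le> g u"
  by (simp add: supermartingale_def)

lemma supermartingale_const: "0 \<le> r \<Longrightarrow> supermartingale (\<lambda>_. r)"
  by (simp add: supermartingale_def child_norm_const)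

lemma supermartingale_scale: "supermartingale g \<Longrightarrow> 0 \<le> r \<Longrightarrow> supermartingale (\<lambda>u. r * g u)"
  by (simp add: supermartingale_def child_norm_scale mult_left_mono)

lemma supermartingale_add:
  "supermartingale g \<Longrightarrow> supermartingale h \<Longrightarrow> supermartingale (\<lambda>u. g u + h u)"
  unfolding supermartingale_def using order_trans[OF child_norm_add add_mono] by force

lemma supermartingale_sum:
  "(\<And>i. i \<in> I \<Longrightarrow> supermartingale (g i)) \<Longrightarrow> supermartingale (\<lambda>u. \<Sum>i\<in>I. g i u)"
  by (induction I rule: infinite_finite_induct) (auto intro: supermartingale_const supermartingale_add)

lemma supermartingale_min:
  assumes "supermartingale g" "supermartingale h"
  shows "supermartingale (\<lambda>u. min (g u) (h u))"
proof (rule supermartingaleI)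
  show nonneg: "0 \<le> min (g u) (h u)" for u
    using assms by (simp add: supermartingale_nonneg)
  have "child_norm (\<lambda>u. min (g u) (h u)) u \<le> child_norm g u"
    "child_norm (\<lambda>u. min (g u) (h u)) u \<le> child_norm h u" for u
    using nonneg by (auto intro: child_norm_mono)
  then show "child_norm (\<lambda>u. min (g u) (h u)) u \<le> min (g u) (h u)" for u
    using assms supermartingale_child_norm_le by (meson min.boundedI order_trans)
qed

lemma supermartingale_tendsto:
  assumes F: "\<And>k. supermartingale (F k)" and lim: "\<And>u. (\<lambda>k. F k u) \<longlonglongrightarrow> G u"
  shows "supermartingale G"
proof (rule supermartingaleI)
  show "0 \<le> G u" for u
    by (rule LIMSEQ_le_const[OF lim]) (simp add: supermartingale_nonneg[OF F])
  show "child_norm G u \<le> G u" for u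
    by (rule LIMSEQ_le[OF child_norm_tendsto[OF lim] lim])
      (simp add: supermartingale_child_norm_le[OF F])
qed

lemma supermartingale_SUP:
  assumes F: "\<And>k. supermartingale (F k)" and inc: "\<And>u. incseq (\<lambda>k. F k u)"
    and bdd: "\<And>u. bdd_above (range (\<lambda>k. F k u))"
  shows "supermartingale (\<lambda>u. SUP k. F k u)"
  by (rule supermartingale_tendsto[OF F LIMSEQ_incseq_SUP[OF bdd inc]])

lemma supermartingale_switch_at:
  assumes W: "supermartingale W" and G: "\<And>v. P v \<Longrightarrow> supermartingale (G v)"
    and le: "\<And>v. P v \<Longrightarrow> G v v \<le> W v"
  shows "supermartingale (switch_at P W G)"
proof (rule supermartingaleI)
  show nonneg: "0 \<le> switch_at P W G u" for u
    using supermartingale_nonneg[OF W] supermartingale_nonneg[OF G[OF find_prefixes_SomeD(1)]]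
    by (auto simp: switch_at_def split: option.split)
  show "child_norm (switch_at P W G) u \<le> switch_at P W G u" for u
  proof (cases "List.find P (prefixes u)")
    case None
    have "switch_at P W G (u @ [a]) \<le> W (u @ [a])" for a
      using None le by (simp add: switch_at_def find_append)
    then have "child_norm (switch_at P W G) u \<le> child_norm W u"
      using nonneg by (auto intro: child_norm_mono)
    also have "\<dots> \<le> W u" by (rule supermartingale_child_norm_le[OF W])
    finally show ?thesis using None by (simp add: switch_at_def)
  next
    case (Some v)
    then have "child_norm (switch_at P W G) u = child_norm (G v) u"
      by (intro child_norm_cong) (simp add: switch_at_def find_append)
    also have "\<dots> \<le> G v u"
      by (rule supermartingale_child_norm_le[OF G[OF find_prefixes_SomeD(1)[OF Some]]])
    finally show ?thesis using Some by (simp add: switch_at_def)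
  qed
qed

section \<open>Conditional capacities\<close>

text \<open>Asking for \<open>1 \<le> g\<close> infinitely often along a branch, rather than once, makes the condition
  independent of the node at which \<open>g\<close> is evaluated.\<close>

definition captures :: "(nat \<Rightarrow> 'a) set \<Rightarrow> ('a list \<Rightarrow> real) \<Rightarrow> bool" where
  "captures A g \<longleftrightarrow> supermartingale g \<and> (\<forall>x\<in>A. \<exists>\<^sub>F j in sequentially. 1 \<le> g (prefix_of x j))"

definition cond_cap :: "(nat \<Rightarrow> 'a) set \<Rightarrow> 'a list \<Rightarrow> real" where
  "cond_cap A u = (INF g\<in>{g. captures A g}. g u)"

lemma captures_supermartingale: "captures A g \<Longrightarrow> supermartingale g"
  by (simp add: captures_def)

lemma captures_frequently:
  "captures A g \<Longrightarrow> x \<in> A \<Longrightarrow> \<exists>\<^sub>F j in sequentially. 1 \<le> g (prefix_of x j)"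
  by (simp add: captures_def)

lemma captures_reaches: "captures A g \<Longrightarrow> x \<in> A \<Longrightarrow> \<exists>j\<ge>N. 1 \<le> g (prefix_of x j)"
  by (auto simp: captures_def frequently_sequentially)

lemma captures_weaken:
  "captures A g \<Longrightarrow> supermartingale h \<Longrightarrow> (\<And>u. 1 \<le> g u \<Longrightarrow> 1 \<le> h u) \<Longrightarrow> captures A h"
  unfolding captures_def by (blast intro: frequently_elim1)

lemma captures_Un: "captures (A \<union> B) g \<longleftrightarrow> captures A g \<and> captures B g"
  by (auto simp: captures_def)

lemma captures_UN: "I \<noteq> {} \<Longrightarrow> captures (\<Union>i\<in>I. A i) g \<longleftrightarrow> (\<forall>i\<in>I. captures (A i) g)"
  by (auto simp: captures_def)

lemma captures_one: "captures A (\<lambda>_. 1)"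
  by (simp add: captures_def supermartingale_const)

lemma cond_cap_le: "captures A g \<Longrightarrow> cond_cap A u \<le> g u"
  unfolding cond_cap_def
  by (rule cINF_lower)
    (auto intro!: bdd_belowI[of _ 0] simp: supermartingale_nonneg[OF captures_supermartingale])

lemma cond_cap_greatest: "(\<And>g. captures A g \<Longrightarrow> r \<le> g u) \<Longrightarrow> r \<le> cond_cap A u"
  unfolding cond_cap_def by (rule cINF_greatest) (use captures_one in auto)

lemma cond_cap_approx: "0 < e \<Longrightarrow> \<exists>g. captures A g \<and> g u < cond_cap A u + e"
  using cond_cap_greatest[of A "cond_cap A u + e" u] by force

lemma cond_cap_nonneg: "0 \<le> cond_cap A u"
  by (rule cond_cap_greatest) (rule supermartingale_nonneg[OF captures_supermartingale])

lemma cond_cap_le_1: "cond_cap A u \<le> 1"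
  using cond_cap_le[OF captures_one] .

lemma cond_cap_mono: "A \<subseteq> B \<Longrightarrow> cond_cap A u \<le> cond_cap B u"
  by (rule cond_cap_greatest, rule cond_cap_le) (auto simp: captures_def)

lemma cond_cap_eq_0_if_disjoint:
  assumes "\<And>x. x \<in> A \<Longrightarrow> prefix_of x (length s) \<noteq> s"
  shows "cond_cap A s = 0"
proof -
  define g :: "'a list \<Rightarrow> real" where "g u = (if prefix s u then 0 else 1)" for u
  have "child_norm g u \<le> g u" for u
  proof (cases "prefix s u")
    case True
    then have "child_norm g u = child_norm (\<lambda>_. 0) u"
      by (intro child_norm_cong) (simp add: g_def)
    with True show ?thesis by (simp add: g_def child_norm_const)
  next
    case False
    have "child_norm g u \<le> child_norm (\<lambda>_. 1) u"
      by (rule child_norm_mono) (simp_all add: g_def)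
    with False show ?thesis by (simp add: g_def child_norm_const)
  qed
  moreover have "g (prefix_of x j) = 1" if "x \<in> A" for x j
    using assms[OF that] by (simp add: g_def prefix_prefix_of_iff)
  ultimately have "captures A g"
    by (simp add: captures_def supermartingale_def) (simp add: g_def)
  from cond_cap_le[OF this, of s] cond_cap_nonneg[of A s] show ?thesis by (simp add: g_def)
qed

lemma cond_cap_Un: "cond_cap (A \<union> B) u \<le> cond_cap A u + cond_cap B u"
proof (rule field_le_epsilon)
  fix e :: real assume "0 < e"
  then obtain g h where g: "captures A g" "g u < cond_cap A u + e/2"
    and h: "captures B h" "h u < cond_cap B u + e/2"
    using cond_cap_approx[of "e/2"] by (metis half_gt_zero)
  have super: "supermartingale (\<lambda>u. g u + h u)"
    using g(1) h(1) by (intro supermartingale_add captures_supermartingale)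
  have "0 \<le> g v" "0 \<le> h v" for v
    using g(1) h(1) by (simp_all add: captures_supermartingale supermartingale_nonneg)
  then have "captures (A \<union> B) (\<lambda>u. g u + h u)"
    unfolding captures_Un
    using captures_weaken[OF g(1) super] captures_weaken[OF h(1) super]
    by (simp add: add_increasing add_increasing2)
  from cond_cap_le[OF this, of u] g(2) h(2)
  show "cond_cap (A \<union> B) u \<le> cond_cap A u + cond_cap B u + e" by simp
qed

text \<open>Follow \<open>W\<close> until it dominates \<open>cond_cap A\<close>, then switch to a nearly optimal
  supermartingale for the node reached.\<close>

lemma cond_cap_optional_stopping:
  assumes W: "supermartingale W"
    and reach: "\<And>x. x \<in> A \<Longrightarrow> \<exists>j\<ge>length s. cond_cap A (prefix_of x j) \<le> W (prefix_of x j)"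
  shows "cond_cap A s \<le> W s"
proof (rule field_le_epsilon)
  fix e :: real assume e: "0 < e"
  obtain G where G: "\<And>v. captures A (G v)" "\<And>v. G v v < cond_cap A v + e"
    using cond_cap_approx[OF e] by metis
  define P where "P v \<longleftrightarrow> length s \<le> length v \<and> cond_cap A v \<le> W v" for v
  define U where "U = switch_at P (\<lambda>v. W v + e) G"
  have G_le: "G v v \<le> W v + e" if "P v" for v
    using that G(2)[of v] by (simp add: P_def)
  have "captures A U"
    unfolding captures_def
  proof (intro conjI ballI)
    show "supermartingale U"
      unfolding U_def using W G(1) G_le e
      by (intro supermartingale_switch_at supermartingale_add supermartingale_const)
        (auto intro: captures_supermartingale)
    fix x assume x: "x \<in> A"
    then obtain j where "P (prefix_of x j)" using reach by (auto simp: P_def)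
    then obtain v where v: "List.find P (prefixes (prefix_of x j)) = Some v"
      by (metis find_None_iff in_set_prefixes not_Some_eq prefix_order.refl)
    have "\<forall>\<^sub>F i in sequentially. U (prefix_of x i) = G v (prefix_of x i)"
      using eventually_ge_at_top[of j]
      by eventually_elim (simp add: U_def switch_at_def find_prefixes_prefix_of_mono[OF _ v])
    then show "\<exists>\<^sub>F i in sequentially. 1 \<le> U (prefix_of x i)"
      by (intro frequently_rev_mp[OF captures_frequently[OF G(1) x]]) (auto elim: eventually_mono)
  qed
  then have "cond_cap A s \<le> U s" by (rule cond_cap_le)
  also have "U s \<le> W s + e"
  proof (cases "List.find P (prefixes s)")
    case (Some v)
    then have "P v" "v = s"
      using find_prefixes_SomeD[OF Some] by (auto simp: P_def prefix_def)
    with Some G_le show ?thesis by (simp add: U_def switch_at_def)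
  qed (simp add: U_def switch_at_def)
  finally show "cond_cap A s \<le> W s + e" .
qed

lemma cond_cap_martingale: "child_norm (cond_cap A) u = cond_cap A u"
proof (rule antisym)
  show le: "child_norm (cond_cap A) v \<le> cond_cap A v" for v
  proof (rule cond_cap_greatest)
    fix g assume g: "captures A g"
    have "child_norm (cond_cap A) v \<le> child_norm g v"
      by (intro child_norm_mono cond_cap_nonneg cond_cap_le g)
    also have "\<dots> \<le> g v" by (rule supermartingale_child_norm_le[OF captures_supermartingale[OF g]])
    finally show "child_norm (cond_cap A) v \<le> g v" .
  qed
  define W where "W = (cond_cap A)(u := child_norm (cond_cap A) u)"
  have W: "0 \<le> W v" "W v \<le> cond_cap A v" for v
    by (simp_all add: W_def cond_cap_nonneg child_norm_nonneg le)
  have "cond_cap A u \<le> W u"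
  proof (rule cond_cap_optional_stopping)
    have "child_norm W v \<le> child_norm (cond_cap A) v" for v
      by (intro child_norm_mono W)
    also have "child_norm (cond_cap A) v \<le> W v" for v by (simp add: W_def le)
    finally show "supermartingale W" using W(1) by (intro supermartingaleI)
    fix x
    have "prefix_of x (Suc (length u)) \<noteq> u" by (metis length_prefix_of n_not_Suc_n)
    then show "\<exists>j\<ge>length u. cond_cap A (prefix_of x j) \<le> W (prefix_of x j)"
      by (intro exI[of _ "Suc (length u)"]) (simp add: W_def)
  qed
  then show "cond_cap A u \<le> child_norm (cond_cap A) u" by (simp add: W_def)
qed

lemma supermartingale_cond_cap: "supermartingale (cond_cap A)"
  by (simp add: supermartingale_def cond_cap_nonneg cond_cap_martingale)

lemma maximal_inequality:
  assumes H: "supermartingale H" and \<theta>: "0 < \<theta>"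
    and reach: "\<And>x. x \<in> A \<Longrightarrow> \<exists>j\<ge>length s. \<theta> \<le> H (prefix_of x j)"
  shows "\<theta> * cond_cap A s \<le> H s"
proof -
  have "cond_cap A s \<le> inverse \<theta> * H s"
  proof (rule cond_cap_optional_stopping)
    show "supermartingale (\<lambda>u. inverse \<theta> * H u)" using H \<theta> by (simp add: supermartingale_scale)
    fix x assume "x \<in> A"
    then obtain j where "j \<ge> length s" "\<theta> \<le> H (prefix_of x j)" using reach by blast
    moreover from this have "1 \<le> inverse \<theta> * H (prefix_of x j)" using \<theta> by (simp add: field_simps)
    ultimately show "\<exists>j\<ge>length s. cond_cap A (prefix_of x j) \<le> inverse \<theta> * H (prefix_of x j)"
      using cond_cap_le_1 order_trans by blast
  qed
  with \<theta> show ?thesis by (simp add: field_simps)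
qed

lemma cond_cap_le_supermartingale:
  assumes "supermartingale H"
    and "\<And>x \<theta>. x \<in> A \<Longrightarrow> \<theta> < 1 \<Longrightarrow> \<exists>j\<ge>length s. \<theta> \<le> H (prefix_of x j)"
  shows "cond_cap A s \<le> H s"
  by (rule field_le_mult_one_interval, rule maximal_inequality[OF assms(1)]) (use assms(2) in auto)

text \<open>The truncation keeps the sums bounded at nodes outside the tree, where nothing relates the
  value of a supermartingale to its value at the root.\<close>

lemma captures_UN_SUP_truncated_sum:
  fixes A :: "nat \<Rightarrow> (nat \<Rightarrow> 'a) set"
  assumes g: "\<And>i. captures (A i) (g i)"
  shows "captures (\<Union>i. A i) (\<lambda>u. SUP k. min (\<Sum>i<k. g i u) 1)"
proof -
  define F where "F k u = min (\<Sum>i<k. g i u) 1" for k u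
  have g_nonneg: "0 \<le> g i u" for i u
    by (rule supermartingale_nonneg[OF captures_supermartingale[OF g]])
  have bdd: "bdd_above (range (\<lambda>k. F k u))" for u
    by (rule bdd_aboveI[of _ 1]) (auto simp: F_def)
  have "supermartingale (\<lambda>u. SUP k. F k u)"
  proof (rule supermartingale_SUP)
    show "supermartingale (F k)" for k
      unfolding F_def
      by (intro supermartingale_min supermartingale_sum supermartingale_const
          captures_supermartingale[OF g]) simp
    show "incseq (\<lambda>k. F k u)" for u
      by (rule incseq_SucI) (auto simp: F_def g_nonneg min_le_iff_disj)
  qed (rule bdd)
  moreover have "1 \<le> (SUP k. F k u)" if "1 \<le> g i u" for i u
  proof -
    have "g i u \<le> (\<Sum>i<Suc i. g i u)" using g_nonneg by (simp add: sum_nonneg)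
    with that have "1 = F (Suc i) u" by (simp add: F_def)
    also have "\<dots> \<le> (SUP k. F k u)" by (rule cSUP_upper[OF _ bdd]) simp
    finally show ?thesis .
  qed
  ultimately show ?thesis
    using captures_weaken[OF g] by (subst captures_UN) (auto simp: F_def)
qed

lemma cond_cap_UN_le_suminf:
  assumes "summable (\<lambda>i. cond_cap (A i) s)"
  shows "cond_cap (\<Union>i. A i) s \<le> (\<Sum>i. cond_cap (A i) s)"
proof (rule field_le_epsilon)
  fix e :: real assume e: "0 < e"
  have "\<exists>g. captures (A i) g \<and> g s < cond_cap (A i) s + e * (1/2) ^ Suc i" for i
    using e by (intro cond_cap_approx) simp
  then obtain g where g: "\<And>i. captures (A i) (g i)"
    and g_less: "\<And>i. g i s < cond_cap (A i) s + e * (1/2) ^ Suc i"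
    by metis
  have sums: "(\<lambda>i. cond_cap (A i) s + e * (1/2) ^ Suc i) sums ((\<Sum>i. cond_cap (A i) s) + e)"
    using sums_add[OF summable_sums[OF assms] sums_mult[OF power_half_series, of e]] by simp
  have "cond_cap (\<Union>i. A i) s \<le> (SUP k. min (\<Sum>i<k. g i s) 1)"
    by (rule cond_cap_le[OF captures_UN_SUP_truncated_sum[OF g]])
  also have "\<dots> \<le> (\<Sum>i. cond_cap (A i) s) + e"
  proof (rule cSUP_least)
    fix k
    have "min (\<Sum>i<k. g i s) 1 \<le> (\<Sum>i<k. g i s)" by simp
    also have "\<dots> \<le> (\<Sum>i<k. cond_cap (A i) s + e * (1/2) ^ Suc i)"
      by (intro sum_mono less_imp_le g_less)
    also have "\<dots> \<le> (\<Sum>i. cond_cap (A i) s) + e"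
      using sum_le_suminf[OF sums_summable[OF sums], of "{..<k}"] sums_unique[OF sums] cond_cap_nonneg e
      by simp
    finally show "min (\<Sum>i<k. g i s) 1 \<le> (\<Sum>i. cond_cap (A i) s) + e" .
  qed simp
  finally show "cond_cap (\<Union>i. A i) s \<le> (\<Sum>i. cond_cap (A i) s) + e" .
qed

lemma cond_cap_UN_null: "(\<And>i. cond_cap (A i) s = 0) \<Longrightarrow> cond_cap (\<Union>i. A i) s = 0" for A :: "nat \<Rightarrow> _"
  using cond_cap_UN_le_suminf[of A s] cond_cap_nonneg[of "\<Union>i. A i" s] by simp

section \<open>Density and continuity from below\<close>

lemma cond_cap_null_if_bounded:
  assumes "\<theta> < 1" and le: "\<And>u. cond_cap A u \<le> \<theta>"
  shows "cond_cap A s = 0"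
proof -
  have \<theta>: "0 \<le> \<theta>" using le[of s] cond_cap_nonneg[of A s] by simp
  have bound: "cond_cap A s \<le> \<theta> * g s" if g: "captures A g" for g
  proof (rule cond_cap_optional_stopping)
    show "supermartingale (\<lambda>u. \<theta> * g u)"
      using g \<theta> by (simp add: captures_supermartingale supermartingale_scale)
    fix x assume "x \<in> A"
    then obtain j where j: "j \<ge> length s" "1 \<le> g (prefix_of x j)"
      using captures_reaches[OF g] by blast
    from le have "cond_cap A (prefix_of x j) \<le> \<theta>" .
    also have "\<dots> \<le> \<theta> * g (prefix_of x j)" using j(2) \<theta> by (simp add: mult_le_cancel_left1)
    finally show "\<exists>j\<ge>length s. cond_cap A (prefix_of x j) \<le> \<theta> * g (prefix_of x j)"
      using j(1) by blast
  qed
  have "cond_cap A s \<le> \<theta> * cond_cap A s"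
  proof (cases "\<theta> = 0")
    case True
    then show ?thesis using le[of s] by simp
  next
    case False
    with \<theta> bound have "cond_cap A s / \<theta> \<le> cond_cap A s"
      by (intro cond_cap_greatest) (simp add: field_simps)
    with False \<theta> show ?thesis by (simp add: field_simps)
  qed
  then have "(1 - \<theta>) * cond_cap A s \<le> 0" by (simp add: algebra_simps)
  with assms(1) cond_cap_nonneg[of A s] show ?thesis by (simp add: mult_le_0_iff)
qed

lemma cond_cap_low_density:
  assumes "B \<subseteq> A" "\<theta> < 1" "\<And>x j. x \<in> B \<Longrightarrow> cond_cap A (prefix_of x j) \<le> \<theta>"
  shows "cond_cap B s = 0"
proof (rule cond_cap_null_if_bounded)
  show "cond_cap B u \<le> max \<theta> 0" for u
  proof (cases "\<exists>x\<in>B. prefix_of x (length u) = u")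
    case True
    then obtain x where "x \<in> B" "prefix_of x (length u) = u" by blast
    with assms(3)[of x "length u"] cond_cap_mono[OF assms(1), of u] show ?thesis by simp
  next
    case False
    then have "cond_cap B u = 0" by (intro cond_cap_eq_0_if_disjoint) blast
    then show ?thesis by simp
  qed
qed (use assms(2) in simp)

definition density_points :: "(nat \<Rightarrow> 'a) set \<Rightarrow> (nat \<Rightarrow> 'a) set" where
  "density_points A = {x. \<forall>\<theta><1. \<exists>j. \<theta> < cond_cap A (prefix_of x j)}"

lemma density_pointsD: "x \<in> density_points A \<Longrightarrow> \<theta> < 1 \<Longrightarrow> \<exists>j. \<theta> < cond_cap A (prefix_of x j)"
  by (simp add: density_points_def)

lemma density_points_eq_INT:
  "density_points A = (\<Inter>k. {x. \<exists>j. 1 - inverse (real (Suc k)) < cond_cap A (prefix_of x j)})"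
proof (intro set_eqI iffI)
  fix x assume "x \<in> (\<Inter>k. {x. \<exists>j. 1 - inverse (real (Suc k)) < cond_cap A (prefix_of x j)})"
  then have ex: "\<exists>j. 1 - inverse (real (Suc k)) < cond_cap A (prefix_of x j)" for k by blast
  have "\<exists>j. \<theta> < cond_cap A (prefix_of x j)" if \<theta>: "\<theta> < 1" for \<theta>
  proof -
    obtain k where "inverse (real (Suc k)) < 1 - \<theta>" using reals_Archimedean[of "1 - \<theta>"] \<theta> by auto
    then have "\<theta> < 1 - inverse (real (Suc k))" by simp
    with ex[of k] show ?thesis using less_trans by blast
  qed
  then show "x \<in> density_points A" by (simp add: density_points_def)
qed (auto simp: density_points_def)

lemma Diff_density_points_eq_UN:
  "B - density_points A =
    (\<Union>k. {x \<in> B. \<forall>j. cond_cap A (prefix_of x j) \<le> 1 - inverse (real (Suc k))})"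
  unfolding density_points_eq_INT not_less[symmetric] by blast

lemma cond_cap_Diff_density_points: "cond_cap (A - density_points A) s = 0"
  unfolding Diff_density_points_eq_UN
  by (rule cond_cap_UN_null, rule cond_cap_low_density[of _ A "1 - inverse (real (Suc _))"]) auto

abbreviation cap :: "(nat \<Rightarrow> 'a) set \<Rightarrow> real" where
  "cap A \<equiv> cond_cap A []"

lemma cap_le_if_Diff_null:
  assumes "A - N \<subseteq> B" "cap N = 0"
  shows "cap A \<le> cap B"
proof -
  have "cap A \<le> cap (B \<union> N)" using assms(1) by (intro cond_cap_mono) blast
  also have "\<dots> \<le> cap B + cap N" by (rule cond_cap_Un)
  finally show ?thesis using assms(2) by simp
qed

lemma cap_incseq_tendsto:
  assumes "incseq A"
  shows "(\<lambda>i. cap (A i)) \<longlonglongrightarrow> cap (\<Union>i. A i)"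
proof -
  define H where "H u = (SUP i. cond_cap (A i) u)" for u
  define N where "N = (\<Union>i. A i - density_points (A i))"
  have bdd: "bdd_above (range (\<lambda>i. cond_cap (A i) u))" for u
    by (rule bdd_aboveI[of _ 1]) (auto simp: cond_cap_le_1)
  have inc: "incseq (\<lambda>i. cond_cap (A i) u)" for u
    using assms by (simp add: incseq_def cond_cap_mono)
  have "cap N = 0"
    unfolding N_def by (intro cond_cap_UN_null cond_cap_Diff_density_points)
  then have "cap (\<Union>i. A i) \<le> cap ((\<Union>i. A i) - N)"
    by (rule cap_le_if_Diff_null[OF order_refl])
  also have "\<dots> \<le> H []"
  proof (rule cond_cap_le_supermartingale)
    show "supermartingale H"
      unfolding H_def by (intro supermartingale_SUP supermartingale_cond_cap inc bdd)
    fix x and \<theta> :: real assume "x \<in> (\<Union>i. A i) - N" "\<theta> < 1"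
    then obtain i where "x \<in> density_points (A i)" by (auto simp: N_def)
    then obtain j where "\<theta> < cond_cap (A i) (prefix_of x j)"
      using density_pointsD[OF _ \<open>\<theta> < 1\<close>] by blast
    also have "\<dots> \<le> H (prefix_of x j)" unfolding H_def by (rule cSUP_upper[OF _ bdd]) simp
    finally show "\<exists>j\<ge>length []. \<theta> \<le> H (prefix_of x j)" by (auto intro: less_imp_le)
  qed
  finally have "cap (\<Union>i. A i) \<le> H []" .
  moreover have "H [] \<le> cap (\<Union>i. A i)"
    unfolding H_def by (intro cSUP_least cond_cap_mono) auto
  ultimately have "cap (\<Union>i. A i) = H []" by (rule antisym)
  with LIMSEQ_incseq_SUP[OF bdd inc, of "[]"] show ?thesis by (simp add: H_def)
qed

lemma cap_density_points_le: "cap (density_points A) \<le> cap A"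
  by (rule cond_cap_le_supermartingale[OF supermartingale_cond_cap])
    (auto dest: density_pointsD intro: less_imp_le)

lemma cap_Un_density_points: "cap (A \<union> density_points A) = cap A"
proof (rule antisym)
  have "cap (A \<union> density_points A) \<le> cap (density_points A)"
    by (rule cap_le_if_Diff_null[OF _ cond_cap_Diff_density_points]) auto
  also have "\<dots> \<le> cap A" by (rule cap_density_points_le)
  finally show "cap (A \<union> density_points A) \<le> cap A" .
qed (simp add: cond_cap_mono)

lemma cap_less_if_cond_cap_less:
  assumes "A \<subseteq> B" "x \<in> Pi\<^sub>E UNIV X"
  shows "cond_cap A (prefix_of x j) < cond_cap B (prefix_of x j) \<Longrightarrow> cap A < cap B"
proof (induction j)
  case (Suc j)
  have "child_norm (cond_cap A) (prefix_of x j) < child_norm (cond_cap B) (prefix_of x j)"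
    using Suc.prems assms
    by (intro child_norm_strict_mono[where a = "x j"] cond_cap_nonneg cond_cap_mono)
      (auto simp: prefix_of_Suc)
  then show ?case by (intro Suc.IH) (simp only: cond_cap_martingale)
qed simp

lemma cap_less_cap_Un:
  assumes B: "B \<subseteq> Pi\<^sub>E UNIV X - density_points A" and pos: "0 < cap B"
  shows "cap A < cap (A \<union> B)"
proof -
  define C where "C k = {x \<in> B. \<forall>j. cond_cap A (prefix_of x j) \<le> 1 - inverse (real (Suc k))}" for k
  have "B = (\<Union>k. C k)" using B Diff_density_points_eq_UN[of B A] unfolding C_def by blast
  then obtain k where k: "cap (C k) \<noteq> 0"
    using cond_cap_UN_null[of C "[]"] pos by auto
  obtain s where s: "1 - inverse (real (Suc k)) < cond_cap (C k) s"
    using cond_cap_null_if_bounded[of "1 - inverse (real (Suc k))" "C k" "[]"] k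
    by (force simp: not_less)
  have "0 \<le> 1 - inverse (real (Suc k))" by (simp add: field_simps)
  with s have "cond_cap (C k) s \<noteq> 0" by linarith
  then obtain x where x: "x \<in> C k" "prefix_of x (length s) = s"
    using cond_cap_eq_0_if_disjoint[of "C k" s] by blast
  have "cond_cap A (prefix_of x (length s)) \<le> 1 - inverse (real (Suc k))"
    using x(1) unfolding C_def by blast
  also note s
  also have "cond_cap (C k) s \<le> cond_cap (A \<union> B) s"
    by (rule cond_cap_mono) (auto simp: C_def)
  finally have "cond_cap A (prefix_of x (length s)) < cond_cap (A \<union> B) (prefix_of x (length s))"
    by (simp add: x(2))
  then show ?thesis
    using x(1) B by (intro cap_less_if_cond_cap_less[of A "A \<union> B" x]) (auto simp: C_def)
qed

end

section \<open>Approximation by step functions\<close>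

lemma step_approximation_step: "step_approximation X f h \<Longrightarrow> nonneg_step X (f i)"
  by (simp add: step_approximation_def)

lemma step_approximation_incseq: "step_approximation X f h \<Longrightarrow> x \<in> Pi\<^sub>E UNIV X \<Longrightarrow> incseq (\<lambda>i. f i x)"
  by (simp add: step_approximation_def incseq_SucI)

lemma step_approximation_SUP:
  "step_approximation X f h \<Longrightarrow> x \<in> Pi\<^sub>E UNIV X \<Longrightarrow> (SUP i. ennreal (f i x)) = ennreal (h x)"
  by (simp add: step_approximation_def)

lemma step_approximation_less:
  assumes f: "step_approximation X f h" and x: "x \<in> Pi\<^sub>E UNIV X" and \<theta>: "0 \<le> \<theta>" "\<theta> < h x"
  shows "\<exists>i. \<theta> < f i x"
proof -
  have "ennreal \<theta> < (SUP i. ennreal (f i x))"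
    using \<theta> by (simp add: step_approximation_SUP[OF f x] ennreal_lessI)
  then obtain i where "ennreal \<theta> < ennreal (f i x)" by (auto simp: less_SUP_iff)
  with \<theta>(1) show ?thesis by (auto simp: ennreal_less_iff)
qed

lemma incseq_step_approximation_superlevel:
  assumes f: "step_approximation X f h" and A: "A \<subseteq> Pi\<^sub>E UNIV X"
  shows "incseq (\<lambda>i. {x \<in> A. \<theta> \<le> f i x})"
proof (rule incseq_SucI, rule subsetI)
  fix i x assume x: "x \<in> {x \<in> A. \<theta> \<le> f i x}"
  then have "x \<in> Pi\<^sub>E UNIV X" using A by blast
  then have "f i x \<le> f (Suc i) x" by (rule incseq_SucD[OF step_approximation_incseq[OF f]])
  with x show "x \<in> {x \<in> A. \<theta> \<le> f (Suc i) x}" by simp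
qed

lemma SUP_ennreal_eq_if_tendsto:
  assumes "incseq f" "f \<longlonglongrightarrow> L"
  shows "(SUP i. ennreal (f i)) = ennreal L"
  using assms by (intro SUP_Lim tendsto_ennrealI) (simp add: incseq_def ennreal_leI)

lemma lower_semicontinuous_indicator:
  assumes "openin T U"
  shows "lower_semicontinuous T (indicator U)"
  unfolding lower_semicontinuous_def
proof
  fix r :: real
  have "{x \<in> topspace T. r < indicator U x} = (if r < 0 then topspace T else if r < 1 then U else {})"
    using openin_subset[OF assms] by (auto simp: indicator_def split: if_splits)
  then show "openin T {x \<in> topspace T. r < indicator U x}" using assms by simp
qed

definition cylinder_INF :: "(nat \<Rightarrow> 'a set) \<Rightarrow> ((nat \<Rightarrow> 'a) \<Rightarrow> real) \<Rightarrow> nat \<Rightarrow> (nat \<Rightarrow> 'a) \<Rightarrow> real" where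
  "cylinder_INF X h N x = (INF y\<in>cylinder X (prefix_of x N). h y)"

lemma depends_below_cylinder_INF: "depends_below X N (cylinder_INF X h N)"
  by (simp add: cylinder_INF_def depends_below_def)

context
  fixes X :: "nat \<Rightarrow> 'a set" and h :: "(nat \<Rightarrow> 'a) \<Rightarrow> real" and x :: "nat \<Rightarrow> 'a"
  assumes h_nonneg: "\<And>y. y \<in> Pi\<^sub>E UNIV X \<Longrightarrow> 0 \<le> h y"
    and x: "x \<in> Pi\<^sub>E UNIV X"
begin

lemma self_in_cylinder: "x \<in> cylinder X (prefix_of x N)"
  using x by (simp add: in_cylinder_prefix_of)

lemma bdd_below_image_cylinder: "bdd_below (h ` cylinder X s)"
  using h_nonneg by (intro bdd_belowI[of _ 0]) (auto simp: cylinder_def)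

lemma cylinder_INF_nonneg: "0 \<le> cylinder_INF X h N x"
  unfolding cylinder_INF_def
  by (rule cINF_greatest) (use self_in_cylinder h_nonneg in \<open>auto simp: cylinder_def\<close>)

lemma cylinder_INF_le: "cylinder_INF X h N x \<le> h x"
  unfolding cylinder_INF_def by (rule cINF_lower[OF bdd_below_image_cylinder self_in_cylinder])

lemma incseq_cylinder_INF: "incseq (\<lambda>N. cylinder_INF X h N x)"
  unfolding cylinder_INF_def
  by (rule incseq_SucI,
      rule cINF_superset_mono[OF _ bdd_below_image_cylinder cylinder_prefix_of_antimono])
    (use self_in_cylinder in auto)

lemma cylinder_INF_tendsto:
  assumes lsc: "lower_semicontinuous (product_space X) h"
  shows "(\<lambda>N. cylinder_INF X h N x) \<longlonglongrightarrow> h x"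
proof (rule increasing_tendsto)
  show "\<forall>\<^sub>F N in sequentially. cylinder_INF X h N x \<le> h x"
    by (simp add: cylinder_INF_le)
  fix r assume "r < h x"
  then obtain t where t: "r < t" "t < h x" using dense by blast
  have "openin (product_space X) {y \<in> topspace (product_space X). t < h y}"
    using lsc by (simp only: lower_semicontinuous_def)
  moreover have "x \<in> {y \<in> topspace (product_space X). t < h y}" using x t(2) by simp
  ultimately obtain N where "cylinder X (prefix_of x N) \<subseteq> {y \<in> topspace (product_space X). t < h y}"
    using cylinder_subset_openin by blast
  then have "t \<le> cylinder_INF X h N x"
    unfolding cylinder_INF_def using self_in_cylinder by (intro cINF_greatest) auto
  with t(1) have "r < cylinder_INF X h M x" if "N \<le> M" for M
    using incseqD[OF incseq_cylinder_INF that] by linarith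
  then show "\<forall>\<^sub>F M in sequentially. r < cylinder_INF X h M x"
    by (auto simp: eventually_sequentially)
qed

end

section \<open>Step functions and the limit norm\<close>

context good_norm_sequence
begin

text \<open>Entries outside \<open>X i\<close> are replaced, so that \<open>extension u\<close> lies in the product for every list \<open>u\<close>.\<close>

definition extension :: "'a list \<Rightarrow> nat \<Rightarrow> 'a" where
  "extension u i = (if i < length u \<and> u ! i \<in> X i then u ! i else (SOME a. a \<in> X i))"

definition tree :: "'a list set" where
  "tree = {u. \<forall>i<length u. u ! i \<in> X i}"

lemma Nil_in_tree: "[] \<in> tree"
  by (simp add: tree_def)

lemma snoc_in_tree_iff: "u @ [a] \<in> tree \<longleftrightarrow> u \<in> tree \<and> a \<in> X (length u)"
  by (force simp: tree_def nth_append less_Suc_eq)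

lemma prefix_of_in_tree: "x \<in> Pi\<^sub>E UNIV X \<Longrightarrow> prefix_of x j \<in> tree"
  by (auto simp: tree_def prefix_of_def)

lemma extension_in_PiE: "extension u \<in> Pi\<^sub>E UNIV X"
  using nonempty_X by (auto simp: extension_def some_in_eq)

lemma prefix_of_extension: "u \<in> tree \<Longrightarrow> prefix_of (extension u) (length u) = u"
  by (intro nth_equalityI) (auto simp: prefix_of_def extension_def tree_def)

lemma prefix_of_extension_append:
  "N \<le> length u \<Longrightarrow> prefix_of (extension (u @ v)) N = prefix_of (extension u) N"
  by (auto simp: prefix_of_eq_iff extension_def nth_append)

lemma depends_below_extension_append:
  assumes "depends_below X N f" "N \<le> length u"
  shows "f (extension (u @ v)) = f (extension u)"
  using assms by (intro depends_belowD[OF assms(1)] extension_in_PiE prefix_of_extension_append)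

lemma depends_below_extension_prefix_of:
  assumes "depends_below X N f" "x \<in> Pi\<^sub>E UNIV X" "N \<le> M"
  shows "f (extension (prefix_of x M)) = f x"
  using depends_below_mono[OF assms(1,3)] extension_in_PiE assms(2)
  by (rule depends_belowD) (use prefix_of_extension[OF prefix_of_in_tree[OF assms(2)], of M] in simp)

lemma funpow_child_norm_nonneg: "(\<And>u. 0 \<le> F u) \<Longrightarrow> 0 \<le> (child_norm ^^ k) F u"
  by (cases k) (auto simp: child_norm_nonneg)

lemma funpow_child_norm_mono:
  assumes "\<And>u. 0 \<le> F u"
  shows "s \<in> tree \<Longrightarrow> (\<And>u. u \<in> tree \<Longrightarrow> length u = length s + k \<Longrightarrow> F u \<le> G u) \<Longrightarrow>
    (child_norm ^^ k) F s \<le> (child_norm ^^ k) G s"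
proof (induction k arbitrary: s)
  case (Suc k)
  have "child_norm ((child_norm ^^ k) F) s \<le> child_norm ((child_norm ^^ k) G) s"
    by (rule child_norm_mono, rule funpow_child_norm_nonneg[OF assms], rule Suc.IH)
      (use Suc.prems in \<open>auto simp: snoc_in_tree_iff\<close>)
  then show ?case by simp
qed simp

lemma funpow_child_norm_cong:
  "s \<in> tree \<Longrightarrow> (\<And>u. u \<in> tree \<Longrightarrow> length u = length s + k \<Longrightarrow> F u = G u) \<Longrightarrow>
    (child_norm ^^ k) F s = (child_norm ^^ k) G s"
proof (induction k arbitrary: s)
  case (Suc k)
  have "child_norm ((child_norm ^^ k) F) s = child_norm ((child_norm ^^ k) G) s"
    by (rule child_norm_cong, rule Suc.IH) (use Suc.prems in \<open>auto simp: snoc_in_tree_iff\<close>)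
  then show ?case by simp
qed simp

lemma funpow_child_norm_le_supermartingale:
  assumes "supermartingale g"
  shows "(child_norm ^^ k) g u \<le> g u"
proof (induction k arbitrary: u)
  case (Suc k)
  have "(child_norm ^^ Suc k) g u \<le> child_norm g u"
    unfolding funpow.simps o_apply
    by (rule child_norm_mono)
      (simp_all add: Suc.IH funpow_child_norm_nonneg supermartingale_nonneg[OF assms])
  also have "\<dots> \<le> g u" by (rule supermartingale_child_norm_le[OF assms])
  finally show ?case .
qed simp

lemma funpow_child_norm_depends_below:
  assumes "depends_below X N f" "\<And>x. x \<in> Pi\<^sub>E UNIV X \<Longrightarrow> 0 \<le> f x"
  shows "N \<le> length u \<Longrightarrow> (child_norm ^^ k) (\<lambda>v. f (extension v)) u = f (extension u)"
proof (induction k arbitrary: u)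
  case (Suc k)
  have "(child_norm ^^ Suc k) (\<lambda>v. f (extension v)) u = child_norm (\<lambda>_. f (extension u)) u"
    unfolding funpow.simps o_apply
    by (rule child_norm_cong)
      (use Suc in \<open>simp add: depends_below_extension_append[OF assms(1)]\<close>)
  then show ?case using assms(2)[OF extension_in_PiE] by (simp add: child_norm_const)
qed simp

definition step_martingale :: "((nat \<Rightarrow> 'a) \<Rightarrow> real) \<Rightarrow> nat \<Rightarrow> 'a list \<Rightarrow> real" where
  "step_martingale f N u = (child_norm ^^ (N - length u)) (\<lambda>v. f (extension v)) u"

lemma step_martingale_nonneg: "(\<And>x. x \<in> Pi\<^sub>E UNIV X \<Longrightarrow> 0 \<le> f x) \<Longrightarrow> 0 \<le> step_martingale f N u"
  unfolding step_martingale_def by (intro funpow_child_norm_nonneg) (simp add: extension_in_PiE)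

lemma supermartingale_step_martingale:
  assumes f: "depends_below X N f" "\<And>x. x \<in> Pi\<^sub>E UNIV X \<Longrightarrow> 0 \<le> f x"
  shows "supermartingale (step_martingale f N)"
proof (rule supermartingaleI)
  show "0 \<le> step_martingale f N u" for u by (rule step_martingale_nonneg[OF f(2)])
  show "child_norm (step_martingale f N) u \<le> step_martingale f N u" for u
  proof (cases "length u < N")
    case True
    then have "N - length u = Suc (N - Suc (length u))" by simp
    then have "step_martingale f N u = child_norm (step_martingale f N) u"
      by (simp add: step_martingale_def child_norm_def)
    then show ?thesis by simp
  next
    case False
    then have "child_norm (step_martingale f N) u = child_norm (\<lambda>_. f (extension u)) u"
      by (intro child_norm_cong) (simp add: step_martingale_def depends_below_extension_append[OF f(1)])
    with False f(2)[OF extension_in_PiE] show ?thesis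
      by (simp add: step_martingale_def child_norm_const)
  qed
qed

lemma step_martingale_prefix_of:
  "depends_below X N f \<Longrightarrow> x \<in> Pi\<^sub>E UNIV X \<Longrightarrow> step_martingale f N (prefix_of x N) = f x"
  by (simp add: step_martingale_def depends_below_extension_prefix_of)

lemma step_martingale_Nil_le:
  assumes f: "depends_below X N f" "\<And>x. x \<in> Pi\<^sub>E UNIV X \<Longrightarrow> 0 \<le> f x"
    and g: "supermartingale g" "\<And>x. x \<in> Pi\<^sub>E UNIV X \<Longrightarrow> f x \<le> g (prefix_of x N)"
  shows "step_martingale f N [] \<le> g []"
proof -
  have "step_martingale f N [] = (child_norm ^^ N) (\<lambda>u. f (extension u)) []"
    by (simp add: step_martingale_def)
  also have "\<dots> \<le> (child_norm ^^ N) g []"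
  proof (rule funpow_child_norm_mono)
    show "0 \<le> f (extension u)" for u by (rule f(2)[OF extension_in_PiE])
    show "f (extension u) \<le> g u" if "u \<in> tree" "length u = length [] + N" for u
      using g(2)[OF extension_in_PiE, of u] prefix_of_extension[OF that(1)] that(2) by simp
  qed (rule Nil_in_tree)
  also have "\<dots> \<le> g []" by (rule funpow_child_norm_le_supermartingale[OF g(1)])
  finally show ?thesis .
qed

lemma step_martingale_Nil_eq:
  assumes "depends_below X N f" "\<And>x. x \<in> Pi\<^sub>E UNIV X \<Longrightarrow> 0 \<le> f x" "N \<le> M"
  shows "step_martingale f M [] = step_martingale f N []"
proof -
  have "step_martingale f M [] =
      (child_norm ^^ N) ((child_norm ^^ (M - N)) (\<lambda>u. f (extension u))) []"
    using funpow_add[of N "M - N" child_norm] assms(3) by (simp add: step_martingale_def)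
  also have "\<dots> = (child_norm ^^ N) (\<lambda>u. f (extension u)) []"
    by (intro funpow_child_norm_cong Nil_in_tree funpow_child_norm_depends_below[OF assms(1,2)]) simp_all
  finally show ?thesis by (simp add: step_martingale_def)
qed

lemma iterated_norm_eq_funpow:
  "iterated_norm n j f =
    (child_norm ^^ Suc j) (\<lambda>u. f (\<lambda>i. if i < length u then u ! i else undefined)) []"
proof (induction j arbitrary: f)
  case 0
  have "(\<lambda>_. undefined)(0 := a) = (\<lambda>i. if i = 0 then ([] @ [a]) ! i else undefined)" for a :: 'a
    by auto
  then show ?case by (simp add: child_norm_def)
next
  case (Suc j)
  let ?fn = "\<lambda>u i. if i < length u then u ! i else (undefined :: 'a)"
  have fn: "(?fn u)(length u := a) = ?fn (u @ [a])" for u a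
    by (auto simp: nth_append)
  have "iterated_norm n (Suc j) f = (child_norm ^^ Suc j) (\<lambda>u. n (Suc j) (\<lambda>a. f ((?fn u)(Suc j := a)))) []"
    by (simp add: norm_iteration_def Suc.IH del: funpow.simps)
  also have "\<dots> = (child_norm ^^ Suc j) (child_norm (\<lambda>u. f (?fn u))) []"
  proof (rule funpow_child_norm_cong[OF Nil_in_tree])
    fix u :: "'a list" assume "length u = length [] + Suc j"
    then show "n (Suc j) (\<lambda>a. f ((?fn u)(Suc j := a))) = child_norm (\<lambda>u. f (?fn u)) u"
      unfolding child_norm_def fn[symmetric] by simp
  qed
  also have "\<dots> = (child_norm ^^ Suc (Suc j)) (\<lambda>u. f (?fn u)) []"
    by (simp add: funpow_swap1)
  finally show ?case .
qed

lemma iterated_norm_step_witness: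
  assumes "step_witness X f j f'"
  shows "iterated_norm n j f' = step_martingale f (Suc j) []"
proof -
  have "f' (\<lambda>i. if i < length u then u ! i else undefined) = f (extension u)"
    if u: "u \<in> tree" "length u = Suc j" for u
  proof -
    have "restrict (extension u) {..j} = (\<lambda>i. if i < length u then u ! i else undefined)"
      using u by (auto simp: extension_def tree_def restrict_def)
    then show ?thesis using assms extension_in_PiE[of u] by (simp add: step_witness_def)
  qed
  then have "iterated_norm n j f' = (child_norm ^^ Suc j) (\<lambda>u. f (extension u)) []"
    unfolding iterated_norm_eq_funpow by (intro funpow_child_norm_cong Nil_in_tree) simp
  then show ?thesis by (simp add: step_martingale_def del: funpow.simps)
qed

lemma step_witness_depends_below: "step_witness X f j f' \<Longrightarrow> depends_below X (Suc j) f"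
proof (rule depends_belowI)
  fix x y assume f: "step_witness X f j f'" and x: "x \<in> Pi\<^sub>E UNIV X" and y: "y \<in> Pi\<^sub>E UNIV X"
    and "prefix_of x (Suc j) = prefix_of y (Suc j)"
  then have "restrict x {..j} = restrict y {..j}"
    by (auto simp: prefix_of_eq_iff restrict_def)
  with f x y show "f x = f y" by (simp add: step_witness_def)
qed

lemma step_witness_exists:
  assumes "depends_below X N f"
  shows "\<exists>f'. step_witness X f N f'"
proof (intro exI)
  show "step_witness X f N (\<lambda>s. f (\<lambda>i. if i \<le> N then s i else (SOME a. a \<in> X i)))"
    unfolding step_witness_def
  proof
    fix x assume x: "x \<in> Pi\<^sub>E UNIV X"
    show "f x = f (\<lambda>i. if i \<le> N then restrict x {..N} i else (SOME a. a \<in> X i))"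
      by (rule depends_belowD[OF depends_below_mono[OF assms le_SucI[OF order_refl]] x])
        (use PiE_mem[OF x] nonempty_X in \<open>auto simp: prefix_of_eq_iff some_in_eq\<close>)
  qed
qed

lemma nonneg_stepI:
  "depends_below X N f \<Longrightarrow> (\<And>x. x \<in> Pi\<^sub>E UNIV X \<Longrightarrow> 0 \<le> f x) \<Longrightarrow> nonneg_step X f"
  unfolding nonneg_step_def using step_witness_exists[of N f] by blast

lemma nonneg_stepE:
  assumes "nonneg_step X f"
  obtains N where "depends_below X N f"
  using assms step_witness_depends_below unfolding nonneg_step_def by blast

lemma nonneg_step_nonneg: "nonneg_step X f \<Longrightarrow> x \<in> Pi\<^sub>E UNIV X \<Longrightarrow> 0 \<le> f x"
  by (simp add: nonneg_step_def)

lemma limit_norm_step_eq: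
  assumes f: "depends_below X N f" "\<And>x. x \<in> Pi\<^sub>E UNIV X \<Longrightarrow> 0 \<le> f x"
  shows "limit_norm_step X (iterated_norm n) f = step_martingale f N []"
  unfolding limit_norm_step_def
proof (rule the_equality)
  obtain f' where f': "step_witness X f N f'"
    using step_witness_exists[OF f(1)] by blast
  moreover have "step_martingale f N [] = iterated_norm n N f'"
    using iterated_norm_step_witness[OF f'] step_martingale_Nil_eq[OF f, of "Suc N"] by simp
  ultimately show "\<exists>j f'. step_witness X f j f' \<and> step_martingale f N [] = iterated_norm n j f'"
    by blast
next
  fix r assume "\<exists>j f'. step_witness X f j f' \<and> r = iterated_norm n j f'"
  then obtain j f' where f': "step_witness X f j f'" "r = iterated_norm n j f'" by blast
  have "r = step_martingale f (Suc j) []"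
    unfolding f'(2) by (rule iterated_norm_step_witness[OF f'(1)])
  also have "\<dots> = step_martingale f (max N (Suc j)) []"
    using step_martingale_Nil_eq[OF step_witness_depends_below[OF f'(1)] f(2), of "max N (Suc j)"]
    by simp
  also have "\<dots> = step_martingale f N []"
    using step_martingale_Nil_eq[OF f, of "max N (Suc j)"] by simp
  finally show "r = step_martingale f N []" .
qed

abbreviation step_norm :: "((nat \<Rightarrow> 'a) \<Rightarrow> real) \<Rightarrow> real" where
  "step_norm \<equiv> limit_norm_step X (iterated_norm n)"

lemma step_norm_nonneg:
  assumes "nonneg_step X f"
  shows "0 \<le> step_norm f"
proof -
  obtain N where "depends_below X N f" using assms by (rule nonneg_stepE)
  from limit_norm_step_eq[OF this nonneg_step_nonneg[OF assms]] show ?thesis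
    by (simp add: step_martingale_nonneg nonneg_step_nonneg[OF assms])
qed

lemma step_norm_le_supermartingale:
  assumes "depends_below X N f" "\<And>x. x \<in> Pi\<^sub>E UNIV X \<Longrightarrow> 0 \<le> f x"
    and "supermartingale g" "\<And>x. x \<in> Pi\<^sub>E UNIV X \<Longrightarrow> f x \<le> g (prefix_of x N)"
  shows "step_norm f \<le> g []"
  using step_martingale_Nil_le[OF assms] by (simp add: limit_norm_step_eq[OF assms(1,2)])

lemma step_norm_le_add:
  assumes f: "nonneg_step X f" and g: "nonneg_step X g" and e: "0 \<le> e"
    and le: "\<And>x. x \<in> Pi\<^sub>E UNIV X \<Longrightarrow> f x \<le> g x + e"
  shows "step_norm f \<le> step_norm g + e"
proof -
  obtain N where N: "depends_below X N f" using f by (rule nonneg_stepE)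
  obtain M where M: "depends_below X M g" using g by (rule nonneg_stepE)
  have dep: "depends_below X (max N M) f" "depends_below X (max N M) g"
    using depends_below_mono[OF N] depends_below_mono[OF M] by simp_all
  have "step_norm f \<le> step_martingale g (max N M) [] + e"
  proof (rule step_norm_le_supermartingale[OF dep(1) nonneg_step_nonneg[OF f]])
    show "supermartingale (\<lambda>u. step_martingale g (max N M) u + e)"
      using e g
      by (intro supermartingale_add supermartingale_const supermartingale_step_martingale[OF dep(2)]
          nonneg_step_nonneg[OF g])
    show "f x \<le> step_martingale g (max N M) (prefix_of x (max N M)) + e" if "x \<in> Pi\<^sub>E UNIV X" for x
      using le[OF that] by (simp add: step_martingale_prefix_of[OF dep(2) that])
  qed
  then show ?thesis by (simp add: limit_norm_step_eq[OF dep(2) nonneg_step_nonneg[OF g]])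
qed

lemma step_approximation_cylinder_INF:
  assumes "lower_semicontinuous (product_space X) h" "\<And>x. x \<in> Pi\<^sub>E UNIV X \<Longrightarrow> 0 \<le> h x"
  shows "step_approximation X (cylinder_INF X h) h"
  unfolding step_approximation_def
proof (intro conjI allI ballI)
  show "nonneg_step X (cylinder_INF X h N)" for N
    by (rule nonneg_stepI[OF depends_below_cylinder_INF cylinder_INF_nonneg[OF assms(2)]])
  fix x assume x: "x \<in> Pi\<^sub>E UNIV X"
  have inc: "incseq (\<lambda>N. cylinder_INF X h N x)"
    by (rule incseq_cylinder_INF[OF assms(2) x])
  then show "cylinder_INF X h N x \<le> cylinder_INF X h (Suc N) x" for N by (rule incseq_SucD)
  show "(SUP N. ennreal (cylinder_INF X h N x)) = ennreal (h x)"
    by (rule SUP_ennreal_eq_if_tendsto[OF inc cylinder_INF_tendsto[OF assms(2) x assms(1)]])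
qed

lemma step_approximation_indicator:
  assumes "incseq U" "\<And>N. depends_below X N (\<lambda>x. x \<in> U N)"
  shows "step_approximation X (\<lambda>N. indicator (U N)) (indicator (\<Union>N. U N))"
  unfolding step_approximation_def
proof (intro conjI allI ballI)
  show "nonneg_step X (indicator (U N))" for N
    by (rule nonneg_stepI[OF depends_below_indicator[OF assms(2)]]) simp
  fix x
  have inc: "incseq (\<lambda>N. indicator (U N) x :: real)"
    using assms(1) by (auto simp: incseq_def indicator_def)
  then show "(indicator (U N) x :: real) \<le> indicator (U (Suc N)) x" for N by (rule incseq_SucD)
  show "(SUP N. ennreal (indicator (U N) x)) = ennreal (indicator (\<Union>N. U N) x)"
    by (rule SUP_ennreal_eq_if_tendsto[OF inc LIMSEQ_indicator_incseq[OF assms(1)]])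
qed

lemma compact_product_space: "compact_space (product_space X)"
  by (simp add: compact_space_product_topology compact_space_discrete_topology finite_X)

lemma closedin_step_add_le:
  assumes "nonneg_step X f" "nonneg_step X g"
  shows "closedin (product_space X) {x \<in> Pi\<^sub>E UNIV X. g x + e \<le> f x}"
proof -
  obtain N where N: "depends_below X N f" using assms(1) by (rule nonneg_stepE)
  obtain M where M: "depends_below X M g" using assms(2) by (rule nonneg_stepE)
  have "depends_below X (max N M) (\<lambda>x. g x + e \<le> f x)"
    using depends_below_compose2[of X "max N M" g f "\<lambda>a b. a + e \<le> b"]
      depends_below_mono[OF N, of "max N M"] depends_below_mono[OF M, of "max N M"]
    by simp
  then show ?thesis by (rule closedin_depends_below)
qed

text \<open>Dini's theorem: the sets where \<open>g k + e \<le> f\<close> are compact and decrease to the empty set.\<close>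

lemma step_approximation_uniform:
  assumes g: "step_approximation X g h" and f: "nonneg_step X f" and e: "0 < e"
    and le: "\<And>x. x \<in> Pi\<^sub>E UNIV X \<Longrightarrow> ennreal (f x) \<le> ennreal (h x)"
  shows "\<exists>k. \<forall>x\<in>Pi\<^sub>E UNIV X. f x \<le> g k x + e"
proof (rule ccontr)
  assume neg: "\<not> ?thesis"
  define C where "C k = {x \<in> Pi\<^sub>E UNIV X. g k x + e \<le> f x}" for k
  have "(\<Inter>k. C k) \<noteq> {}"
  proof (rule compact_space_imp_nest[OF compact_product_space])
    show "closedin (product_space X) (C k)" for k
      unfolding C_def by (intro closedin_step_add_le f step_approximation_step[OF g])
    show "C k \<noteq> {}" for k
    proof -
      obtain y where "y \<in> Pi\<^sub>E UNIV X" "\<not> f y \<le> g k y + e" using neg by blast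
      then have "y \<in> C k" by (simp add: C_def)
      then show ?thesis by blast
    qed
    show "decseq C"
    proof (rule decseq_SucI, rule subsetI)
      fix k x assume x: "x \<in> C (Suc k)"
      then have "g k x \<le> g (Suc k) x"
        using incseq_SucD[OF step_approximation_incseq[OF g]] by (simp add: C_def)
      with x show "x \<in> C k" by (simp add: C_def)
    qed
  qed
  then obtain x where "x \<in> (\<Inter>k. C k)" by blast
  then have x: "x \<in> Pi\<^sub>E UNIV X" "g k x + e \<le> f x" for k by (simp_all add: C_def)
  have "0 \<le> g 0 x" by (rule nonneg_step_nonneg[OF step_approximation_step[OF g] x(1)])
  with x(2)[of 0] e have f_e: "0 \<le> f x - e" "f x - e < f x" by simp_all
  have "ennreal (h x) = (SUP k. ennreal (g k x))" using step_approximation_SUP[OF g x(1)] by simp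
  also have "\<dots> \<le> ennreal (f x - e)"
    using x(2) by (intro SUP_least ennreal_leI) (simp add: le_diff_eq)
  also have "\<dots> < ennreal (f x)" using f_e by (intro ennreal_lessI) auto
  finally show False using le[OF x(1)] by simp
qed

lemma SUP_step_norm_le:
  assumes f: "step_approximation X f h" and g: "step_approximation X g h"
  shows "(SUP i. ennreal (step_norm (f i))) \<le> (SUP i. ennreal (step_norm (g i)))"
proof (rule SUP_least, rule ennreal_le_epsilon)
  fix i and e :: real assume e: "0 < e"
  have "ennreal (f i x) \<le> ennreal (h x)" if "x \<in> Pi\<^sub>E UNIV X" for x
    unfolding step_approximation_SUP[OF f that, symmetric] by (rule SUP_upper) simp
  then obtain k where "\<forall>x\<in>Pi\<^sub>E UNIV X. f i x \<le> g k x + e"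
    using step_approximation_uniform[OF g step_approximation_step[OF f] e] by blast
  then have "step_norm (f i) \<le> step_norm (g k) + e"
    using e by (intro step_norm_le_add step_approximation_step[OF f] step_approximation_step[OF g]) auto
  then have "ennreal (step_norm (f i)) \<le> ennreal (step_norm (g k)) + ennreal e"
    using e step_norm_nonneg[OF step_approximation_step[OF g]]
    by (simp add: ennreal_leI flip: ennreal_plus)
  also have "ennreal (step_norm (g k)) \<le> (SUP i. ennreal (step_norm (g i)))" by (rule SUP_upper) simp
  finally show "ennreal (step_norm (f i)) \<le> (SUP i. ennreal (step_norm (g i))) + ennreal e"
    by (simp add: add_right_mono)
qed

lemma limit_norm_lsc_eq:
  assumes "step_approximation X f h"
  shows "limit_norm_lsc X (iterated_norm n) h = (SUP i. ennreal (step_norm (f i)))"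
  unfolding limit_norm_lsc_def
  by (rule the_equality) (use assms in \<open>blast intro: antisym SUP_step_norm_le\<close>)+

section \<open>The derived submeasure as a capacity\<close>

abbreviation limit_cap :: "(nat \<Rightarrow> 'a) set \<Rightarrow> ennreal" where
  "limit_cap \<equiv> derived_submeasure (limit_norm X (iterated_norm n))"

text \<open>Stopping \<open>g\<close> at value 1 makes the sets \<open>{x. 1 \<le> absorb g (prefix_of x N)}\<close> increase with \<open>N\<close>.\<close>

definition absorb :: "('a list \<Rightarrow> real) \<Rightarrow> 'a list \<Rightarrow> real" where
  "absorb g = switch_at (\<lambda>v. 1 \<le> g v) g (\<lambda>_ _. 1)"

definition hits :: "('a list \<Rightarrow> real) \<Rightarrow> (nat \<Rightarrow> 'a) set" where
  "hits g = {x \<in> Pi\<^sub>E UNIV X. \<exists>j. 1 \<le> g (prefix_of x j)}"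

lemma supermartingale_absorb: "supermartingale g \<Longrightarrow> supermartingale (absorb g)"
  unfolding absorb_def by (rule supermartingale_switch_at) (simp_all add: supermartingale_const)

lemma absorb_Nil_le: "absorb g [] \<le> g []"
  by (simp add: absorb_def switch_at_def)

lemma one_le_absorb_iff: "1 \<le> absorb g u \<longleftrightarrow> (\<exists>v. prefix v u \<and> 1 \<le> g v)"
proof (cases "List.find (\<lambda>v. 1 \<le> g v) (prefixes u)")
  case None
  then have "\<not> 1 \<le> g v" if "prefix v u" for v using that by (auto simp: find_None_iff)
  with None show ?thesis by (auto simp: absorb_def switch_at_def)
next
  case (Some v)
  with find_prefixes_SomeD[OF Some] show ?thesis by (auto simp: absorb_def switch_at_def)
qed

lemma one_le_absorb_prefix_of_iff: "1 \<le> absorb g (prefix_of x N) \<longleftrightarrow> (\<exists>j\<le>N. 1 \<le> g (prefix_of x j))"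
  unfolding one_le_absorb_iff prefix_prefix_of_iff by (metis length_prefix_of)

lemma openin_hits: "openin (product_space X) (hits g)"
  unfolding hits_def by (rule openin_ex_prefix_of)

lemma hits_subset: "hits g \<subseteq> Pi\<^sub>E UNIV X"
  by (auto simp: hits_def)

lemma captures_subset_hits: "captures A g \<Longrightarrow> A \<subseteq> Pi\<^sub>E UNIV X \<Longrightarrow> A \<subseteq> hits g"
  using captures_reaches[of A g _ 0] by (auto simp: hits_def)

lemma cap_hits_le: "supermartingale g \<Longrightarrow> cap (hits g) \<le> g []"
  using maximal_inequality[of g 1 "hits g" "[]"] by (simp add: hits_def)

lemma limit_norm_lsc_indicator_hits_le:
  assumes g: "supermartingale g"
  shows "limit_norm_lsc X (iterated_norm n) (indicator (hits g)) \<le> ennreal (g [])"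
proof -
  define U where "U N = {x \<in> Pi\<^sub>E UNIV X. 1 \<le> absorb g (prefix_of x N)}" for N
  have hits: "hits g = (\<Union>N. U N)"
    by (auto simp: hits_def U_def one_le_absorb_prefix_of_iff)
  have "incseq U"
    by (rule incseq_SucI) (auto simp: U_def one_le_absorb_prefix_of_iff intro: le_SucI)
  moreover have dep: "depends_below X N (\<lambda>x. x \<in> U N)" for N
    by (rule depends_belowI) (simp add: U_def)
  ultimately have "limit_norm_lsc X (iterated_norm n) (indicator (hits g)) =
      (SUP N. ennreal (step_norm (indicator (U N))))"
    unfolding hits by (intro limit_norm_lsc_eq step_approximation_indicator)
  also have "\<dots> \<le> ennreal (g [])"
  proof (intro SUP_least ennreal_leI)
    fix N
    have "step_norm (indicator (U N)) \<le> absorb g []"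
    proof (rule step_norm_le_supermartingale[OF _ _ supermartingale_absorb[OF g]])
      show "depends_below X N (indicator (U N) :: _ \<Rightarrow> real)"
        by (rule depends_below_indicator[OF dep])
      show "indicator (U N) x \<le> absorb g (prefix_of x N)" for x
        using supermartingale_nonneg[OF supermartingale_absorb[OF g]] by (simp add: U_def indicator_def)
    qed simp
    also have "\<dots> \<le> g []" by (rule absorb_Nil_le)
    finally show "step_norm (indicator (U N)) \<le> g []" .
  qed
  finally show ?thesis .
qed

lemma limit_cap_le_cap:
  assumes A: "A \<subseteq> Pi\<^sub>E UNIV X"
  shows "limit_cap A \<le> ennreal (cap A)"
proof (rule ennreal_le_epsilon)
  fix e :: real assume e: "0 < e"
  obtain g where g: "captures A g" "g [] < cap A + e"
    using cond_cap_approx[OF e] by blast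
  have "limit_cap A \<le> limit_norm_lsc X (iterated_norm n) (indicator (hits g))"
    unfolding derived_submeasure_def limit_norm_def
  proof (intro Inf_lower CollectI exI[of _ "indicator (hits g)"] conjI refl ballI)
    show "lower_semicontinuous (product_space X) (indicator (hits g))"
      by (rule lower_semicontinuous_indicator[OF openin_hits])
    show "\<bar>indicator A x\<bar> \<le> (indicator (hits g) x :: real)" for x
      using captures_subset_hits[OF g(1) A] by (auto simp: indicator_def)
  qed
  also have "\<dots> \<le> ennreal (g [])"
    by (rule limit_norm_lsc_indicator_hits_le[OF captures_supermartingale[OF g(1)]])
  also have "\<dots> \<le> ennreal (cap A) + ennreal e"
    using g(2) e cond_cap_nonneg[of A "[]"] by (simp add: ennreal_leI flip: ennreal_plus)
  finally show "limit_cap A \<le> ennreal (cap A) + ennreal e" .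
qed

lemma step_norm_maximal_inequality:
  assumes f: "nonneg_step X f" and A: "A \<subseteq> Pi\<^sub>E UNIV X"
    and \<theta>: "0 < \<theta>" "\<And>x. x \<in> A \<Longrightarrow> \<theta> \<le> f x"
  shows "\<theta> * cap A \<le> step_norm f"
proof -
  obtain N where N: "depends_below X N f" using f by (rule nonneg_stepE)
  have "\<theta> * cap A \<le> step_martingale f N []"
  proof (rule maximal_inequality[OF supermartingale_step_martingale[OF N nonneg_step_nonneg[OF f]] \<theta>(1)])
    fix x assume "x \<in> A"
    then have "\<theta> \<le> step_martingale f N (prefix_of x N)"
      using \<theta>(2) step_martingale_prefix_of[OF N] A by auto
    then show "\<exists>j\<ge>length []. \<theta> \<le> step_martingale f N (prefix_of x j)" by auto
  qed
  then show ?thesis by (simp add: limit_norm_step_eq[OF N nonneg_step_nonneg[OF f]])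
qed

lemma cap_le_SUP_step_norm:
  assumes f: "step_approximation X f h" and A: "A \<subseteq> Pi\<^sub>E UNIV X"
    and h: "\<And>x. x \<in> A \<Longrightarrow> 1 \<le> h x"
  shows "ennreal (cap A) \<le> (SUP i. ennreal (step_norm (f i)))"
proof (cases "SUP i. ennreal (step_norm (f i))")
  case (real r)
  have step_norm_le: "step_norm (f i) \<le> r" for i
    using SUP_upper[of i UNIV "\<lambda>i. ennreal (step_norm (f i))"] real by simp
  have "cap A \<le> r"
  proof (rule field_le_mult_one_interval)
    fix \<theta> :: real assume \<theta>: "0 < \<theta>" "\<theta> < 1"
    define B where "B i = {x \<in> A. \<theta> \<le> f i x}" for i
    have "incseq B" unfolding B_def by (rule incseq_step_approximation_superlevel[OF f A])
    then have "(\<lambda>i. \<theta> * cap (B i)) \<longlonglongrightarrow> \<theta> * cap (\<Union>i. B i)"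
      by (intro tendsto_mult_left cap_incseq_tendsto)
    moreover have "\<theta> * cap (B i) \<le> r" for i
    proof -
      have "\<theta> * cap (B i) \<le> step_norm (f i)"
        using A by (intro step_norm_maximal_inequality step_approximation_step[OF f] \<theta>(1)) (auto simp: B_def)
      also have "\<dots> \<le> r" by (rule step_norm_le)
      finally show ?thesis .
    qed
    moreover have "(\<Union>i. B i) = A"
    proof -
      have "\<exists>i. \<theta> \<le> f i x" if "x \<in> A" for x
        using step_approximation_less[OF f subsetD[OF A that], of \<theta>] h[OF that] \<theta>
        by (auto intro: less_imp_le)
      then show ?thesis by (auto simp: B_def)
    qed
    ultimately show "\<theta> * cap A \<le> r" by (auto intro: LIMSEQ_le_const2)
  qed
  then show ?thesis unfolding real(2) by (rule ennreal_leI)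
next
  case top
  show ?thesis unfolding top by simp
qed

lemma cap_le_limit_cap:
  assumes A: "A \<subseteq> Pi\<^sub>E UNIV X"
  shows "ennreal (cap A) \<le> limit_cap A"
  unfolding derived_submeasure_def limit_norm_def
proof (intro Inf_greatest, elim CollectE exE conjE)
  fix z g assume z: "z = limit_norm_lsc X (iterated_norm n) g"
    and lsc: "lower_semicontinuous (product_space X) g"
    and g: "\<forall>x\<in>Pi\<^sub>E UNIV X. \<bar>indicator A x\<bar> \<le> g x"
  have "0 \<le> g x" if "x \<in> Pi\<^sub>E UNIV X" for x
    using g that abs_ge_zero order_trans by blast
  then have approx: "step_approximation X (cylinder_INF X g) g"
    by (rule step_approximation_cylinder_INF[OF lsc])
  show "ennreal (cap A) \<le> z"
    unfolding z limit_norm_lsc_eq[OF approx]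
    using g A by (intro cap_le_SUP_step_norm[OF approx A]) force
qed

lemma limit_cap_eq: "A \<subseteq> Pi\<^sub>E UNIV X \<Longrightarrow> limit_cap A = ennreal (cap A)"
  by (intro antisym limit_cap_le_cap cap_le_limit_cap)

lemma capacity_limit_cap: "capacity_on (product_space X) limit_cap"
  unfolding capacity_on_def topspace_product_space
proof (intro conjI allI impI; (elim conjE)?)
  show "Polish_space (product_space X)"
    by (intro Polish_product_space countable_finite finite_X)
  show "limit_cap {} = 0"
    using cond_cap_eq_0_if_disjoint[of "{}" "[]"] by (simp add: limit_cap_eq)
  show "limit_cap A \<le> limit_cap B" if "A \<subseteq> B" "B \<subseteq> Pi\<^sub>E UNIV X" for A B
    using that cond_cap_mono[OF that(1)] by (simp add: limit_cap_eq ennreal_leI)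
  show "limit_cap (A \<union> B) \<le> limit_cap A + limit_cap B"
    if "A \<subseteq> Pi\<^sub>E UNIV X" "B \<subseteq> Pi\<^sub>E UNIV X" for A B
    using that ennreal_leI[OF cond_cap_Un[of A B "[]"]]
    by (simp add: limit_cap_eq cond_cap_nonneg)
  show "limit_cap (\<Union>i. A i) = (SUP i. limit_cap (A i))"
    if A: "\<forall>i. A i \<subseteq> Pi\<^sub>E UNIV X" and inc: "incseq A" for A :: "nat \<Rightarrow> (nat \<Rightarrow> 'a) set"
  proof -
    have "incseq (\<lambda>i. cap (A i))" using inc by (simp add: incseq_def cond_cap_mono)
    then have "(SUP i. ennreal (cap (A i))) = ennreal (cap (\<Union>i. A i))"
      by (rule SUP_ennreal_eq_if_tendsto[OF _ cap_incseq_tendsto[OF inc]])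
    with A show ?thesis by (simp add: limit_cap_eq UN_least)
  qed
  show "limit_cap K < \<infinity>" if "compactin (product_space X) K" for K
    using compactin_subset_topspace[OF that] by (simp add: limit_cap_eq)
qed

lemma outer_regular_limit_cap: "outer_regular (product_space X) limit_cap"
  unfolding outer_regular_def topspace_product_space
proof (intro allI impI antisym)
  fix A assume A: "A \<subseteq> Pi\<^sub>E UNIV X"
  show "limit_cap A \<le> Inf {limit_cap U |U. openin (product_space X) U \<and> A \<subseteq> U}"
  proof (rule Inf_greatest, elim CollectE exE conjE)
    fix z U assume "z = limit_cap U" "openin (product_space X) U" "A \<subseteq> U"
    then show "limit_cap A \<le> z"
      using openin_subset[of "product_space X" U] A
      by (simp add: limit_cap_eq ennreal_leI cond_cap_mono)
  qed
  show "Inf {limit_cap U |U. openin (product_space X) U \<and> A \<subseteq> U} \<le> limit_cap A"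
    unfolding limit_cap_eq[OF A]
  proof (rule ennreal_le_epsilon)
    fix e :: real assume e: "0 < e"
    obtain g where g: "captures A g" "g [] < cap A + e"
      using cond_cap_approx[OF e] by blast
    have "Inf {limit_cap U |U. openin (product_space X) U \<and> A \<subseteq> U} \<le> limit_cap (hits g)"
      using openin_hits captures_subset_hits[OF g(1) A] by (intro Inf_lower) auto
    also have "\<dots> = ennreal (cap (hits g))" by (rule limit_cap_eq[OF hits_subset])
    also have "\<dots> \<le> ennreal (cap A + e)"
      using cap_hits_le[OF captures_supermartingale[OF g(1)]] g(2) by (intro ennreal_leI) simp
    also have "\<dots> = ennreal (cap A) + ennreal e"
      using e by (intro ennreal_plus cond_cap_nonneg) simp
    finally show "Inf {limit_cap U |U. openin (product_space X) U \<and> A \<subseteq> U}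
        \<le> ennreal (cap A) + ennreal e" .
  qed
qed

lemma density_points_in_Borel:
  "Pi\<^sub>E UNIV X \<inter> density_points A \<in> sigma_sets (Pi\<^sub>E UNIV X) {U. openin (product_space X) U}"
proof -
  define U where "U k = {x \<in> Pi\<^sub>E UNIV X. \<exists>j. 1 - inverse (real (Suc k)) < cond_cap A (prefix_of x j)}" for k
  have "Pi\<^sub>E UNIV X \<inter> density_points A = (\<Inter>k. U k)"
    by (auto simp: density_points_eq_INT U_def)
  also have "\<dots> \<in> sigma_sets (Pi\<^sub>E UNIV X) {U. openin (product_space X) U}"
  proof (rule sigma_sets_INTER)
    show "{U. openin (product_space X) U} \<subseteq> Pow (Pi\<^sub>E UNIV X)"
      using openin_subset by fastforce
    show "U k \<in> sigma_sets (Pi\<^sub>E UNIV X) {U. openin (product_space X) U}" for k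
      unfolding U_def by (intro sigma_sets.Basic CollectI openin_ex_prefix_of)
  qed simp
  finally show ?thesis .
qed

lemma stable_limit_cap: "stable_capacity (product_space X) limit_cap"
  unfolding stable_capacity_def topspace_product_space
proof (intro allI impI)
  fix A assume open_A: "openin (product_space X) A"
  then have A: "A \<subseteq> Pi\<^sub>E UNIV X" using openin_subset by fastforce
  define A' where "A' = A \<union> Pi\<^sub>E UNIV X \<inter> density_points A"
  have A': "A' \<subseteq> Pi\<^sub>E UNIV X" using A by (auto simp: A'_def)
  have "cap A' \<le> cap (A \<union> density_points A)" "cap A \<le> cap A'"
    by (auto simp: A'_def intro: cond_cap_mono)
  then have cap_A': "cap A' = cap A" by (simp add: cap_Un_density_points)
  have "limit_cap A < limit_cap (A \<union> B)" if B: "B \<subseteq> Pi\<^sub>E UNIV X - A'" "0 < limit_cap B" for B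
  proof -
    have BX: "B \<subseteq> Pi\<^sub>E UNIV X" using B(1) by blast
    then have "0 < cap B" using B(2) by (simp add: limit_cap_eq)
    moreover have "B \<subseteq> Pi\<^sub>E UNIV X - density_points A" using B(1) by (auto simp: A'_def)
    ultimately have "cap A < cap (A \<union> B)" by (intro cap_less_cap_Un)
    then show ?thesis
      using A BX cond_cap_nonneg[of A "[]"] by (simp add: limit_cap_eq ennreal_lessI le_less_trans)
  qed
  moreover have "A' \<in> sigma_sets (Pi\<^sub>E UNIV X) {U. openin (product_space X) U}"
    unfolding A'_def using open_A by (intro sigma_sets_Un density_points_in_Borel) auto
  moreover have "A \<subseteq> A'" "limit_cap A' = limit_cap A"
    using A A' cap_A' by (simp_all add: A'_def limit_cap_eq)
  ultimately show "\<exists>A'\<in>sigma_sets (Pi\<^sub>E UNIV X) {U. openin (product_space X) U}.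
      A \<subseteq> A' \<and> limit_cap A' = limit_cap A \<and>
      (\<forall>B. B \<subseteq> Pi\<^sub>E UNIV X - A' \<and> 0 < limit_cap B \<longrightarrow> limit_cap A < limit_cap (A \<union> B))"
    by blast
qed

end

theorem mainTheorem15:
  fixes X :: "nat \<Rightarrow> 'a set"
    and n :: "nat \<Rightarrow> ('a \<Rightarrow> real) \<Rightarrow> real"
    and c :: "(nat \<Rightarrow> 'a) set \<Rightarrow> ennreal"
  assumes "\<And>i. finite (X i)"
    and "\<And>i. X i \<noteq> {}"
    and "\<And>i. good_norm (X i) (n i)"
    and "c = derived_submeasure (limit_norm X (iterated_norm n))"
  shows "capacity_on (product_space X) c \<and>
         outer_regular (product_space X) c \<and>
         stable_capacity (product_space X) c"
proof -
  interpret good_norm_sequence X n by unfold_locales (fact assms)+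
  show ?thesis
    unfolding assms(4)
    by (intro conjI capacity_limit_cap outer_regular_limit_cap stable_limit_cap)
qed

end
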